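(* Let $T>0$ and let $\varphi\in L^2(\mathbb{R})$ be such that $\{\varphi(\cdot-nT)\}_{n\in\mathbb{Z}}$ is a Riesz sequence in $L^2(\mathbb{R})$. Assume that $V_T(\varphi)$ is a reproducing kernel Hilbert space and that its reproducing kernel $k(s,t)$ satisfies the condition that $\{k(\cdot,t+nT)\}_{n\in\mathbb{Z}}$ is a frame for $V_T(\varphi)$ for each $t\in[0,T]$. Then $\sum_{k\in\mathbb{Z}}\delta_{kT}$ identifies $\mathcal{H}_{T,\varphi}$, that is, there are constants $c,C>0$ with $$c\,\|H\|_{HS}\leq\Big\|H\sum_{k\in\mathbb{Z}}\delta_{kT}\Big\|_{L^2}\leq C\,\|H\|_{HS},\quad H\in\mathcal{H}_{T,\varphi}.$$ The reconstruction of operators $H\in\mathcal{H}_{T,\varphi}$ is possible by $$h_H(t,x)=\chi_{[0,T]}(t)\sum_{n\in\mathbb{Z}}\Big(H\sum_{k\in\mathbb{Z}}\delta_{kT}\Big)(t+nT)\,k_n^*(x,t),$$ where $\{k_n^*(\cdot,t)\}_{n\in\mathbb{Z}}$ is a dual frame of $\{k(\cdot,t+nT)\}_{n\in\mathbb{Z}}$ for a.e. $t\in[0,T]$.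
   Context: $HS(L^2(\mathbb{R}))$ is the space of operators $Hf(x)=\int\kappa_H(x,t)f(t)\,dt$ with $\kappa_H\in L^2(\mathbb{R}^2)$, $\|H\|_{HS}=\|\kappa_H\|_{L^2}$. The time-varying impulse response is $h_H(t,x)=\kappa_H(x,x-t)$, so $Hf(x)=\int h_H(t,x)f(x-t)\,dt$ and $\|H\|_{HS}=\|h_H\|_{L^2(\mathbb{R}^2)}$. $V_T(\varphi)=\overline{\operatorname{span}}\{\varphi(\cdot-nT)\}_{n\in\mathbb{Z}}=\{\sum_nc_n\varphi(\cdot-nT):\{c_n\}\in\ell^2\}\subseteq L^2(\mathbb{R})$. $\mathcal{H}_{T,\varphi}\subseteq HS(L^2(\mathbb{R}))$ consists of the operators $H$ with $h_H\in L^2[0,T]\otimes V_T(\varphi)$ (Hilbert space tensor product; thus $h_H(t,x)$ vanishes for $t\notin[0,T]$ and $h_H(t,\cdot)\in V_T(\varphi)$ for a.e. $t$). A Hilbert space $X$ of complex-valued functions on $D\neq\emptyset$ is a reproducing kernel Hilbert space with reproducing kernel $k(s,t)$ on $D\times D$ if $k(\cdot,t)\in X$ for all $t\in D$ and $f(t)=\langle f,k(\cdot,t)\rangle_X$ for all $f\in X$, $t\in D$. Here $X=V_T(\varphi)$ with the $L^2$ inner product and $D=\mathbb{R}$, and $h_H(t,\cdot)$ is evaluated pointwise as an element of this function space. The action on the delta train is $(H\sum_{k\in\mathbb{Z}}\delta_{kT})(x)=\sum_{k\in\mathbb{Z}}h_H(x-kT,x)$. A sequence $\{f_k\}$ in a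 Hilbert space $X$ is a frame if there are $A,B>0$ with $A\|f\|^2\leq\sum_k|\langle f,f_k\rangle|^2\leq B\|f\|^2$ for all $f\in X$; a dual frame $\{\widetilde f_k\}$ is a frame with $f=\sum_k\langle f,f_k\rangle\widetilde f_k=\sum_k\langle f,\widetilde f_k\rangle f_k$ for all $f\in X$. A Riesz sequence is a sequence that is a Riesz basis of its closed span.
   Formalization: The norm equivalence is proved assuming the frames {k(·,t+nT)} have bounds A, B independent of t in [0,T]; with t-dependent bounds it fails, e.g. T=1, φ(x)=x^(-1/4) on (0,1], 0 elsewhere. The reconstruction needs only a frame for each t. *)

theory Defs
  imports "HOL-Analysis.Analysis"
begin

section \<open>Square-integrable functions\<close>

text \<open>Elements of \<open>L2 M\<close> are functions, not classes modulo null sets. The sets below that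
  stand for closed subspaces of the Hilbert space (such as \<open>closed_span\<close>) are closed under
  changes on null sets.\<close>

definition L2 :: "'a measure \<Rightarrow> ('a \<Rightarrow> complex) set" where
  "L2 M = {f \<in> borel_measurable M. integrable M (\<lambda>x. (cmod (f x))\<^sup>2)}"

definition L2_norm :: "'a measure \<Rightarrow> ('a \<Rightarrow> complex) \<Rightarrow> real" where
  "L2_norm M f = sqrt (LINT x|M. (cmod (f x))\<^sup>2)"

definition L2_inner :: "'a measure \<Rightarrow> ('a \<Rightarrow> complex) \<Rightarrow> ('a \<Rightarrow> complex) \<Rightarrow> complex" where
  "L2_inner M f g = (LINT x|M. f x * cnj (g x))"

text \<open>Unconditional convergence of a series in the norm of \<open>L2 M\<close>.\<close>

definition L2_has_sum ::
    "'a measure \<Rightarrow> ('i \<Rightarrow> 'a \<Rightarrow> complex) \<Rightarrow> ('a \<Rightarrow> complex) \<Rightarrow> bool" where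
  "L2_has_sum M f u \<longleftrightarrow>
     ((\<lambda>F. L2_norm M (\<lambda>x. u x - (\<Sum>i\<in>F. f i x))) \<longlongrightarrow> 0) (finite_subsets_at_top UNIV)"

definition lin_span :: "('a \<Rightarrow> complex) set \<Rightarrow> ('a \<Rightarrow> complex) set" where
  "lin_span S = {(\<lambda>x. \<Sum>s\<in>F. c s * s x) | F c. finite F \<and> F \<subseteq> S}"

definition closed_span :: "'a measure \<Rightarrow> ('a \<Rightarrow> complex) set \<Rightarrow> ('a \<Rightarrow> complex) set" where
  "closed_span M S =
     {f \<in> L2 M. \<forall>\<epsilon>>0. \<exists>g\<in>lin_span S. L2_norm M (\<lambda>x. f x - g x) < \<epsilon>}"


section \<open>Riesz sequences and frames in \<open>L\<^sup>2(\<real>)\<close>\<close>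

definition riesz_basis :: "(real \<Rightarrow> complex) set \<Rightarrow> ('i \<Rightarrow> real \<Rightarrow> complex) \<Rightarrow> bool" where
  "riesz_basis V f \<longleftrightarrow>
     (\<forall>i. f i \<in> L2 lebesgue) \<and> closed_span lebesgue (range f) = V \<and>
     (\<exists>A>0. \<exists>B>0. \<forall>F c. finite F \<longrightarrow>
        A * (\<Sum>i\<in>F. (cmod (c i))\<^sup>2) \<le> (L2_norm lebesgue (\<lambda>x. \<Sum>i\<in>F. c i * f i x))\<^sup>2 \<and>
        (L2_norm lebesgue (\<lambda>x. \<Sum>i\<in>F. c i * f i x))\<^sup>2 \<le> B * (\<Sum>i\<in>F. (cmod (c i))\<^sup>2))"

definition riesz_sequence :: "('i \<Rightarrow> real \<Rightarrow> complex) \<Rightarrow> bool" where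
  "riesz_sequence f \<longleftrightarrow> riesz_basis (closed_span lebesgue (range f)) f"

definition frame_bounds ::
    "(real \<Rightarrow> complex) set \<Rightarrow> ('i \<Rightarrow> real \<Rightarrow> complex) \<Rightarrow> real \<Rightarrow> real \<Rightarrow> bool" where
  "frame_bounds X f A B \<longleftrightarrow> 0 < A \<and> 0 < B \<and> (\<forall>i. f i \<in> X) \<and>
     (\<forall>g\<in>X. (\<lambda>i. (cmod (L2_inner lebesgue g (f i)))\<^sup>2) summable_on UNIV \<and>
        A * (L2_norm lebesgue g)\<^sup>2 \<le> (\<Sum>\<^sub>\<infinity>i. (cmod (L2_inner lebesgue g (f i)))\<^sup>2) \<and>
        (\<Sum>\<^sub>\<infinity>i. (cmod (L2_inner lebesgue g (f i)))\<^sup>2) \<le> B * (L2_norm lebesgue g)\<^sup>2)"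

definition is_frame :: "(real \<Rightarrow> complex) set \<Rightarrow> ('i \<Rightarrow> real \<Rightarrow> complex) \<Rightarrow> bool" where
  "is_frame X f \<longleftrightarrow> (\<exists>A B. frame_bounds X f A B)"

text \<open>The frame bounds of a family of frames \<open>f t\<close>, \<open>t \<in> I\<close>, need not be bounded away from
  0 and \<open>\<infinity>\<close>. For example, let \<open>T = 1\<close> and \<open>\<phi>(x) = x powr (-1/4)\<close> on \<open>(0,1]\<close>, \<open>\<phi> = 0\<close>
  elsewhere. The translates \<open>\<phi>(\<cdot> - n)\<close> are orthogonal, \<open>V_space 1 \<phi>\<close> has the reproducing kernel
  \<open>(\<Sum>n. \<phi>(s - n) * \<phi>(t - n)) / 2\<close>, and its sections at \<open>t + n\<close> form for each \<open>t \<in> (0,1]\<close> a frame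
  whose two optimal bounds are both equal to \<open>t powr (-1/2) / 2\<close> (for \<open>t = 0\<close>: \<open>1/2\<close>). Here
  the delta train does not identify the operator class: the upper inequality fails. The lower one
  fails for \<open>\<phi>(x) = x\<close> on \<open>(0,1]\<close>. Identification requires the frames to have common
  bounds.\<close>

definition uniform_frames ::
    "(real \<Rightarrow> complex) set \<Rightarrow> 'b set \<Rightarrow> ('b \<Rightarrow> 'i \<Rightarrow> real \<Rightarrow> complex) \<Rightarrow> bool" where
  "uniform_frames X I f \<longleftrightarrow> (\<exists>A B. \<forall>t\<in>I. frame_bounds X (f t) A B)"

definition dual_frame ::
    "(real \<Rightarrow> complex) set \<Rightarrow> ('i \<Rightarrow> real \<Rightarrow> complex) \<Rightarrow> ('i \<Rightarrow> real \<Rightarrow> complex) \<Rightarrow> bool" where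
  "dual_frame X f g \<longleftrightarrow> is_frame X g \<and>
     (\<forall>u\<in>X. L2_has_sum lebesgue (\<lambda>i x. L2_inner lebesgue u (f i) * g i x) u \<and>
             L2_has_sum lebesgue (\<lambda>i x. L2_inner lebesgue u (g i) * f i x) u)"


section \<open>Shift-invariant spaces as reproducing kernel Hilbert spaces\<close>

definition V_space :: "real \<Rightarrow> (real \<Rightarrow> complex) \<Rightarrow> (real \<Rightarrow> complex) set" where
  "V_space T \<phi> = closed_span lebesgue (range (\<lambda>(n::int) x. \<phi> (x - of_int n * T)))"

text \<open>\<open>V\<close> is (the union of the classes in) a closed subspace of \<open>L\<^sup>2(\<real>)\<close>. To regard it as a
  space of functions one selects a set \<open>X\<close> of representatives, one for each class,
  that is linear under the pointwise operations. Then \<open>X\<close> with the \<open>L\<^sup>2\<close> inner product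
  is a Hilbert space isometric to the closed subspace.\<close>

definition function_space_of :: "(real \<Rightarrow> complex) set \<Rightarrow> (real \<Rightarrow> complex) set \<Rightarrow> bool" where
  "function_space_of V X \<longleftrightarrow> X \<subseteq> V \<and>
     (\<forall>f\<in>X. \<forall>g\<in>X. (\<lambda>x. f x + g x) \<in> X) \<and> (\<forall>a. \<forall>f\<in>X. (\<lambda>x. a * f x) \<in> X) \<and>
     (\<forall>f\<in>V. \<exists>!g. g \<in> X \<and> (AE x in lebesgue. g x = f x))"

definition reproducing_kernel ::
    "(real \<Rightarrow> complex) set \<Rightarrow> (real \<Rightarrow> real \<Rightarrow> complex) \<Rightarrow> bool" where
  "reproducing_kernel X k \<longleftrightarrow> (\<forall>t. (\<lambda>s. k s t) \<in> X) \<and>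
     (\<forall>f\<in>X. \<forall>t. f t = L2_inner lebesgue f (\<lambda>s. k s t))"


section \<open>Hilbert-Schmidt operators\<close>

text \<open>An operator on \<open>L\<^sup>2(\<real>)\<close> is a map on representatives; only its values on \<open>L2 lebesgue\<close>
  modulo null sets matter. The kernel of a Hilbert-Schmidt operator is unique up to null sets.\<close>

definition is_hs_kernel ::
    "((real \<Rightarrow> complex) \<Rightarrow> (real \<Rightarrow> complex)) \<Rightarrow> (real \<times> real \<Rightarrow> complex) \<Rightarrow> bool" where
  "is_hs_kernel H \<kappa> \<longleftrightarrow> \<kappa> \<in> L2 lebesgue \<and>
     (\<forall>f\<in>L2 lebesgue. AE x in lebesgue. H f x = (LINT t|lebesgue. \<kappa> (x, t) * f t))"

definition HS :: "((real \<Rightarrow> complex) \<Rightarrow> (real \<Rightarrow> complex)) set" where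
  "HS = {H. \<exists>\<kappa>. is_hs_kernel H \<kappa>}"

definition hs_kernel ::
    "((real \<Rightarrow> complex) \<Rightarrow> (real \<Rightarrow> complex)) \<Rightarrow> real \<times> real \<Rightarrow> complex" where
  "hs_kernel H = (SOME \<kappa>. is_hs_kernel H \<kappa>)"

definition hs_norm :: "((real \<Rightarrow> complex) \<Rightarrow> (real \<Rightarrow> complex)) \<Rightarrow> real" where
  "hs_norm H = L2_norm lebesgue (hs_kernel H)"

definition impulse_response ::
    "((real \<Rightarrow> complex) \<Rightarrow> (real \<Rightarrow> complex)) \<Rightarrow> real \<Rightarrow> real \<Rightarrow> complex" where
  "impulse_response H t x = hs_kernel H (x, x - t)"

text \<open>The Hilbert space tensor product of two subspaces of \<open>L\<^sup>2(\<real>)\<close>, realised in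
  \<open>L\<^sup>2(\<real>\<^sup>2)\<close>.\<close>

definition tensor_L2 ::
    "(real \<Rightarrow> complex) set \<Rightarrow> (real \<Rightarrow> complex) set \<Rightarrow> (real \<times> real \<Rightarrow> complex) set" where
  "tensor_L2 U V = closed_span lebesgue {(\<lambda>(t, x). a t * g x) | a g. a \<in> U \<and> g \<in> V}"

definition L2_Icc :: "real \<Rightarrow> (real \<Rightarrow> complex) set" where
  "L2_Icc T = {a \<in> L2 lebesgue. \<forall>t. t \<notin> {0..T} \<longrightarrow> a t = 0}"

definition op_class ::
    "real \<Rightarrow> (real \<Rightarrow> complex) \<Rightarrow> ((real \<Rightarrow> complex) \<Rightarrow> (real \<Rightarrow> complex)) set" where
  "op_class T \<phi> =
     {H \<in> HS. (\<lambda>(t, x). impulse_response H t x) \<in> tensor_L2 (L2_Icc T) (V_space T \<phi>)}"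

text \<open>The impulse response at \<open>t\<close>, evaluated pointwise through the element of the function space
  \<open>X\<close> in its class. That element exists for a.e. \<open>t\<close>, and up to a null set of \<open>t\<close> it
  does not depend on the kernel chosen by \<open>hs_kernel\<close>.\<close>

definition impulse_response_in ::
    "(real \<Rightarrow> complex) set \<Rightarrow> ((real \<Rightarrow> complex) \<Rightarrow> (real \<Rightarrow> complex)) \<Rightarrow> real \<Rightarrow> real \<Rightarrow> complex" where
  "impulse_response_in X H t =
     (THE g. g \<in> X \<and> (AE x in lebesgue. g x = impulse_response H t x))"

definition delta_train_response ::
    "(real \<Rightarrow> complex) set \<Rightarrow> real \<Rightarrow> ((real \<Rightarrow> complex) \<Rightarrow> (real \<Rightarrow> complex)) \<Rightarrow> real \<Rightarrow> complex" where
  "delta_train_response X T H x =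
     (\<Sum>\<^sub>\<infinity>k::int. impulse_response_in X H (x - of_int k * T) x)"

end

theory Submission
  imports Defs
begin

text \<open>Almost every section \<open>h t\<close> of the impulse response has a representative \<open>G t \<in> X\<close>, and for
  \<open>t\<close> in \<open>[0,T]\<close> the response to the delta train samples it: its value at \<open>t + n T\<close> is
  \<open>G t (t + n T)\<close>, the inner product of \<open>G t\<close> with the kernel section at \<open>t + n T\<close>. The frame
  inequalities for \<open>G t\<close>, integrated over \<open>[0,T]\<close>, give the norm equivalence, and the dual frame
  expansion of \<open>G t\<close> is the reconstruction formula. Measurability of \<open>t \<mapsto> G t (t + c)\<close> comes from
  approximating the impulse response by finite sums of elementary tensors: almost all sections
  converge in \<open>X\<close>, hence pointwise. Dual frames are obtained by inverting the frame operator.\<close>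

section \<open>The space of square-integrable functions\<close>

text \<open>The obstacle is that the response to the delta train reads the impulse response along
  the lines x = t + c, which are null sets of the plane: neither joint measurability nor the
  Hilbert-Schmidt norm controls values there. Bounded point evaluations on \<open>X\<close> are what
  makes these values meaningful, with a single exceptional null set of \<open>t\<close> that serves
  all points at once. The same evaluations yield completeness of \<open>X\<close>, on which the
  inversion of the frame operator rests. Common frame bounds enter only where the frame inequalities
  are integrated over \<open>t\<close>; the constants of the norm equivalence are their square
  roots. The reconstruction treats one section at a time.\<close>

lemma L2_iff_nn_integral:
  "f \<in> L2 M \<longleftrightarrow> f \<in> borel_measurable M \<and> (\<integral>\<^sup>+x. ennreal ((cmod (f x))\<^sup>2) \<partial>M) < \<infinity>"
  unfolding L2_def by (auto simp: integrable_iff_bounded)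

lemma L2_measurable: "f \<in> L2 M \<Longrightarrow> f \<in> borel_measurable M"
  by (simp add: L2_def)

lemma L2_norm_nonneg [simp]: "0 \<le> L2_norm M f"
  by (simp add: L2_norm_def)

lemma L2_norm_power2: "(L2_norm M f)\<^sup>2 = (LINT x|M. (cmod (f x))\<^sup>2)"
  by (simp add: L2_norm_def)

lemma ennreal_L2_norm_power2:
  "f \<in> L2 M \<Longrightarrow> ennreal ((L2_norm M f)\<^sup>2) = (\<integral>\<^sup>+x. ennreal ((cmod (f x))\<^sup>2) \<partial>M)"
  unfolding L2_norm_power2 by (subst nn_integral_eq_integral) (auto simp: L2_def)

lemma L2_scale: "f \<in> L2 M \<Longrightarrow> (\<lambda>x. a * f x) \<in> L2 M"
  by (auto simp: L2_def norm_mult power_mult_distrib)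

lemma L2_zero: "(\<lambda>x. 0) \<in> L2 M"
  by (simp add: L2_def)

lemma L2_add:
  assumes "f \<in> L2 M" "g \<in> L2 M"
  shows "(\<lambda>x. f x + g x) \<in> L2 M"
proof -
  have [measurable]: "f \<in> borel_measurable M" "g \<in> borel_measurable M"
    using assms by (auto simp: L2_def)
  have "integrable M (\<lambda>x. 2 * (cmod (f x))\<^sup>2 + 2 * (cmod (g x))\<^sup>2)"
    using assms by (auto simp: L2_def)
  then have "integrable M (\<lambda>x. (cmod (f x + g x))\<^sup>2)"
  proof (rule Bochner_Integration.integrable_bound)
    have "(cmod (f x + g x))\<^sup>2 \<le> 2 * (cmod (f x))\<^sup>2 + 2 * (cmod (g x))\<^sup>2" for x
    proof -
      have "(cmod (f x + g x))\<^sup>2 \<le> (cmod (f x) + cmod (g x))\<^sup>2"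
        by (intro power_mono norm_triangle_ineq) auto
      also have "\<dots> \<le> 2 * (cmod (f x))\<^sup>2 + 2 * (cmod (g x))\<^sup>2"
        using sum_squares_bound[of "cmod (f x)" "cmod (g x)"] by (simp add: power2_sum)
      finally show ?thesis .
    qed
    then show "AE x in M. norm ((cmod (f x + g x))\<^sup>2) \<le> norm (2 * (cmod (f x))\<^sup>2 + 2 * (cmod (g x))\<^sup>2)"
      by auto
  qed auto
  then show ?thesis by (auto simp: L2_def)
qed

lemma L2_diff: "f \<in> L2 M \<Longrightarrow> g \<in> L2 M \<Longrightarrow> (\<lambda>x. f x - g x) \<in> L2 M"
  using L2_add[of f M "\<lambda>x. - 1 * g x"] L2_scale[of g M "-1"] by simp

lemma L2_sum: "(\<And>i. i \<in> F \<Longrightarrow> f i \<in> L2 M) \<Longrightarrow> (\<lambda>x. \<Sum>i\<in>F. f i x) \<in> L2 M"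
  by (induction F rule: infinite_finite_induct) (auto intro: L2_zero L2_add)

lemma borel_measurable_cnj [measurable (raw)]:
  "f \<in> borel_measurable M \<Longrightarrow> (\<lambda>x. cnj (f x)) \<in> borel_measurable M"
  by (rule borel_measurable_continuous_on[of cnj]) (auto intro: continuous_intros)

lemma integrable_mult_cnj:
  assumes "f \<in> L2 M" "g \<in> L2 M"
  shows "integrable M (\<lambda>x. f x * cnj (g x))"
proof -
  have [measurable]: "f \<in> borel_measurable M" "g \<in> borel_measurable M"
    using assms by (auto simp: L2_def)
  have "integrable M (\<lambda>x. (cmod (f x))\<^sup>2 + (cmod (g x))\<^sup>2)"
    using assms by (auto simp: L2_def)
  then show ?thesis
  proof (rule Bochner_Integration.integrable_bound)
    have "cmod (f x * cnj (g x)) \<le> (cmod (f x))\<^sup>2 + (cmod (g x))\<^sup>2" for x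
    proof -
      have "0 \<le> cmod (f x) * cmod (g x)" by simp
      moreover have "2 * cmod (f x) * cmod (g x) \<le> (cmod (f x))\<^sup>2 + (cmod (g x))\<^sup>2"
        by (rule sum_squares_bound)
      ultimately show ?thesis unfolding norm_mult complex_mod_cnj by linarith
    qed
    then show "AE x in M. norm (f x * cnj (g x)) \<le> norm ((cmod (f x))\<^sup>2 + (cmod (g x))\<^sup>2)"
      by (auto simp: abs_of_nonneg)
  qed auto
qed

lemma L2_inner_commute: "L2_inner M g f = cnj (L2_inner M f g)"
proof -
  have "cnj (L2_inner M f g) = (LINT x|M. cnj (f x * cnj (g x)))"
    unfolding L2_inner_def by (rule Bochner_Integration.integral_cnj[symmetric])
  then show ?thesis by (simp add: L2_inner_def mult.commute)
qed

lemma L2_inner_add_left: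
  "f \<in> L2 M \<Longrightarrow> g \<in> L2 M \<Longrightarrow> h \<in> L2 M \<Longrightarrow>
    L2_inner M (\<lambda>x. f x + g x) h = L2_inner M f h + L2_inner M g h"
  unfolding L2_inner_def
  by (simp add: ring_distribs integrable_mult_cnj Bochner_Integration.integral_add)

lemma L2_inner_scale_left: "L2_inner M (\<lambda>x. a * f x) g = a * L2_inner M f g"
  unfolding L2_inner_def by (simp add: mult.assoc)

lemma L2_inner_scale_right: "L2_inner M f (\<lambda>x. a * g x) = cnj a * L2_inner M f g"
  by (subst (1 2) L2_inner_commute) (simp add: L2_inner_scale_left)

lemma L2_inner_add_right:
  "f \<in> L2 M \<Longrightarrow> g \<in> L2 M \<Longrightarrow> h \<in> L2 M \<Longrightarrow>
    L2_inner M h (\<lambda>x. f x + g x) = L2_inner M h f + L2_inner M h g"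
  by (subst (1 2 3) L2_inner_commute) (simp add: L2_inner_add_left)

lemma L2_inner_diff_left:
  "f \<in> L2 M \<Longrightarrow> g \<in> L2 M \<Longrightarrow> h \<in> L2 M \<Longrightarrow>
    L2_inner M (\<lambda>x. f x - g x) h = L2_inner M f h - L2_inner M g h"
  unfolding L2_inner_def
  by (simp add: ring_distribs integrable_mult_cnj Bochner_Integration.integral_diff)

lemma L2_inner_sum_left:
  assumes "\<And>i. i \<in> F \<Longrightarrow> f i \<in> L2 M" "g \<in> L2 M"
  shows "L2_inner M (\<lambda>x. \<Sum>i\<in>F. f i x) g = (\<Sum>i\<in>F. L2_inner M (f i) g)"
  unfolding L2_inner_def sum_distrib_right
  using assms by (intro Bochner_Integration.integral_sum integrable_mult_cnj)

lemma L2_inner_self: "L2_inner M f f = complex_of_real ((L2_norm M f)\<^sup>2)"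
  unfolding L2_inner_def L2_norm_power2
  by (simp add: complex_mult_cnj cmod_power2 flip: integral_complex_of_real)

lemma L2_norm_scale: "L2_norm M (\<lambda>x. a * f x) = cmod a * L2_norm M f"
  by (simp add: L2_norm_def norm_mult power_mult_distrib real_sqrt_mult)

lemma L2_norm_minus_commute: "L2_norm M (\<lambda>x. f x - g x) = L2_norm M (\<lambda>x. g x - f x)"
  by (simp add: L2_norm_def norm_minus_commute)

lemma L2_norm_add_power2:
  assumes "f \<in> L2 M" "g \<in> L2 M"
  shows "(L2_norm M (\<lambda>x. f x + g x))\<^sup>2 =
    (L2_norm M f)\<^sup>2 + 2 * Re (L2_inner M f g) + (L2_norm M g)\<^sup>2"
proof -
  have "complex_of_real ((L2_norm M (\<lambda>x. f x + g x))\<^sup>2) =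
      L2_inner M (\<lambda>x. f x + g x) (\<lambda>x. f x + g x)"
    by (simp only: L2_inner_self)
  also have "\<dots> = L2_inner M f f + L2_inner M f g + cnj (L2_inner M f g) + L2_inner M g g"
    using assms L2_inner_commute[of M g f]
    by (simp add: L2_inner_add_left L2_inner_add_right L2_add)
  finally have "Re (complex_of_real ((L2_norm M (\<lambda>x. f x + g x))\<^sup>2)) =
      Re (L2_inner M f f + L2_inner M f g + cnj (L2_inner M f g) + L2_inner M g g)"
    by simp
  then show ?thesis by (simp only: L2_inner_self Re_complex_of_real plus_complex.sel complex_cnj)simp
qed

lemma L2_inner_cong_AE:
  assumes "f \<in> borel_measurable M" "f' \<in> borel_measurable M" "g \<in> borel_measurable M"
    "AE x in M. f x = f' x"
  shows "L2_inner M f g = L2_inner M f' g"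
proof -
  note [measurable] = assms(1-3)
  show ?thesis unfolding L2_inner_def
    by (rule integral_cong_AE) (use assms(4) in auto)
qed

lemma L2_norm_cong_AE:
  assumes "f \<in> borel_measurable M" "g \<in> borel_measurable M" "AE x in M. f x = g x"
  shows "L2_norm M f = L2_norm M g"
  unfolding L2_norm_def by (intro arg_cong[of _ _ sqrt] integral_cong_AE) (use assms in auto)

lemma L2_norm_eq_0_AE:
  assumes "f \<in> L2 M" "L2_norm M f = 0"
  shows "AE x in M. f x = 0"
proof -
  have "(\<integral>\<^sup>+x. ennreal ((cmod (f x))\<^sup>2) \<partial>M) = 0"
    using ennreal_L2_norm_power2[OF assms(1)] assms(2) by simp
  moreover have "(\<lambda>x. ennreal ((cmod (f x))\<^sup>2)) \<in> borel_measurable M"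
    using L2_measurable[OF assms(1)] by measurable
  ultimately have "AE x in M. ennreal ((cmod (f x))\<^sup>2) = 0"
    by (simp add: nn_integral_0_iff_AE)
  then show ?thesis by eventually_elim simp
qed

lemma L2_Cauchy_Schwarz:
  assumes "f \<in> L2 M" "g \<in> L2 M"
  shows "cmod (L2_inner M f g) \<le> L2_norm M f * L2_norm M g"
proof (cases "L2_norm M g = 0")
  case True
  have "L2_inner M g f = L2_inner M (\<lambda>x. 0) f"
    using L2_norm_eq_0_AE[OF assms(2) True] assms
    by (intro L2_inner_cong_AE) (auto intro: L2_measurable)
  then have "L2_inner M f g = 0"
    using L2_inner_commute[of M f g] by (simp add: L2_inner_def)
  then show ?thesis by simp
next
  case False
  let ?G = "(L2_norm M g)\<^sup>2" and ?z = "L2_inner M f g"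
  have G: "?G > 0" using False by simp
  \<comment> \<open>With this \<open>a\<close> the function f + a g is orthogonal to
    \<open>g\<close>; nonnegativity of its squared norm is the inequality.\<close>
  define a where "a = - ?z / complex_of_real ?G"
  have *: "Re (cnj a * ?z) = - (cmod ?z)\<^sup>2 / ?G"
  proof -
    have "cnj a * ?z = - (?z * cnj ?z) / complex_of_real ?G"
      by (simp add: a_def mult.commute)
    also have "\<dots> = complex_of_real (- (cmod ?z)\<^sup>2 / ?G)"
      by (simp only: complex_norm_square[symmetric] of_real_divide of_real_minus of_real_power)
    finally show ?thesis by simp
  qed
  have "cmod a = cmod ?z / ?G"
    unfolding a_def norm_divide norm_minus_cancel norm_of_real by simp
  then have **: "(cmod a)\<^sup>2 * ?G = (cmod ?z)\<^sup>2 / ?G"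
    using G by (simp add: power_divide power2_eq_square)
  have "0 \<le> (L2_norm M (\<lambda>x. f x + a * g x))\<^sup>2" by simp
  also have "\<dots> = (L2_norm M f)\<^sup>2 + 2 * Re (cnj a * ?z) + (cmod a)\<^sup>2 * ?G"
    using assms
    by (simp add: L2_norm_add_power2 L2_scale L2_inner_scale_right L2_norm_scale power_mult_distrib)
  finally have "(cmod ?z)\<^sup>2 / ?G \<le> (L2_norm M f)\<^sup>2"
    unfolding * ** by simp
  then have "(cmod ?z)\<^sup>2 \<le> (L2_norm M f * L2_norm M g)\<^sup>2"
    using G by (simp add: divide_le_eq power_mult_distrib)
  then show ?thesis by (rule power2_le_imp_le) simp
qed

lemma L2_norm_triangle:
  assumes "f \<in> L2 M" "g \<in> L2 M"
  shows "L2_norm M (\<lambda>x. f x + g x) \<le> L2_norm M f + L2_norm M g"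
proof -
  have "Re (L2_inner M f g) \<le> L2_norm M f * L2_norm M g"
    using L2_Cauchy_Schwarz[OF assms] complex_Re_le_cmod order_trans by blast
  then have "(L2_norm M (\<lambda>x. f x + g x))\<^sup>2 \<le> (L2_norm M f + L2_norm M g)\<^sup>2"
    by (simp add: L2_norm_add_power2[OF assms] power2_sum)
  then show ?thesis by (rule power2_le_imp_le) simp
qed

lemma L2_dist_triangle:
  assumes "f \<in> L2 M" "g \<in> L2 M" "h \<in> L2 M"
  shows "L2_norm M (\<lambda>x. f x - h x) \<le> L2_norm M (\<lambda>x. f x - g x) + L2_norm M (\<lambda>x. g x - h x)"
  using L2_norm_triangle[of "\<lambda>x. f x - g x" M "\<lambda>x. g x - h x"] assms by (simp add: L2_diff)

text \<open>Fatou's lemma for the squared moduli. The bound is asked only from some index on, which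
  is the form a Cauchy condition supplies.\<close>

lemma L2_norm_le_liminf_pointwise:
  assumes u: "\<And>n. u n \<in> L2 M" and f: "f \<in> borel_measurable M"
    and lim: "\<And>x. (\<lambda>n. u n x) \<longlonglongrightarrow> f x"
    and bd: "\<And>n. n \<ge> N \<Longrightarrow> L2_norm M (u n) \<le> e"
  shows "f \<in> L2 M" "L2_norm M f \<le> e"
proof -
  have [measurable]: "u n \<in> borel_measurable M" for n
    using u by (auto intro: L2_measurable)
  have e: "0 \<le> e"
    using bd[of N] by (rule order_trans[rotated]) auto
  have "(\<integral>\<^sup>+x. ennreal ((cmod (f x))\<^sup>2) \<partial>M) =
      (\<integral>\<^sup>+x. liminf (\<lambda>n. ennreal ((cmod (u n x))\<^sup>2)) \<partial>M)"
    by (intro nn_integral_cong lim_imp_Liminf[symmetric] tendsto_intros lim) auto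
  also have "\<dots> \<le> liminf (\<lambda>n. \<integral>\<^sup>+x. ennreal ((cmod (u n x))\<^sup>2) \<partial>M)"
    by (intro nn_integral_liminf) measurable
  also have "\<dots> \<le> liminf (\<lambda>n. ennreal (e\<^sup>2))"
    by (intro Liminf_mono eventually_sequentiallyI[of N])
      (auto simp flip: ennreal_L2_norm_power2[OF u] intro!: ennreal_leI power_mono bd)
  finally have *: "(\<integral>\<^sup>+x. ennreal ((cmod (f x))\<^sup>2) \<partial>M) \<le> ennreal (e\<^sup>2)"
    by (simp add: Liminf_const)
  then show "f \<in> L2 M"
    using f by (simp add: L2_iff_nn_integral le_less_trans[OF *])
  from * have "ennreal ((L2_norm M f)\<^sup>2) \<le> ennreal (e\<^sup>2)"
    by (simp only: ennreal_L2_norm_power2[OF \<open>f \<in> L2 M\<close>])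
  then have "(L2_norm M f)\<^sup>2 \<le> e\<^sup>2" by simp
  then show "L2_norm M f \<le> e" using e by (rule power2_le_imp_le)
qed

section \<open>Reproducing kernel Hilbert spaces\<close>

text \<open>The generators \<open>S\<close> stay abstract; in the application they are the
  translates of \<phi>. \<open>X\<close> fixes one function per class, which gives meaning to values
  at points.\<close>

locale rkhs =
  fixes S :: "(real \<Rightarrow> complex) set" and X :: "(real \<Rightarrow> complex) set"
    and k :: "real \<Rightarrow> real \<Rightarrow> complex"
  assumes generators_L2: "S \<subseteq> L2 lebesgue"
    and fs: "function_space_of (closed_span lebesgue S) X"
    and rk: "reproducing_kernel X k"
begin

abbreviation nrm :: "(real \<Rightarrow> complex) \<Rightarrow> real" where "nrm \<equiv> L2_norm lebesgue"

abbreviation ip :: "(real \<Rightarrow> complex) \<Rightarrow> (real \<Rightarrow> complex) \<Rightarrow> complex" where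
  "ip \<equiv> L2_inner lebesgue"

lemma lin_span_L2: "g \<in> lin_span S \<Longrightarrow> g \<in> L2 lebesgue"
  unfolding lin_span_def using generators_L2 by (auto intro!: L2_sum L2_scale)

lemma X_subset: "u \<in> X \<Longrightarrow> u \<in> closed_span lebesgue S"
  using fs by (auto simp: function_space_of_def)

lemma X_L2: "u \<in> X \<Longrightarrow> u \<in> L2 lebesgue"
  using X_subset by (auto simp: closed_span_def)

lemma X_add: "u \<in> X \<Longrightarrow> v \<in> X \<Longrightarrow> (\<lambda>x. u x + v x) \<in> X"
  and X_scale: "u \<in> X \<Longrightarrow> (\<lambda>x. a * u x) \<in> X"
  using fs by (auto simp: function_space_of_def)

lemma X_kernel: "(\<lambda>s. k s t) \<in> X"
  using rk by (auto simp: reproducing_kernel_def)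

lemma X_zero: "(\<lambda>x. 0) \<in> X"
  using X_scale[OF X_kernel[of 0], of 0] by simp

lemma X_diff: "u \<in> X \<Longrightarrow> v \<in> X \<Longrightarrow> (\<lambda>x. u x - v x) \<in> X"
  using X_add[of u "\<lambda>x. - 1 * v x"] X_scale[of v "-1"] by simp

lemma X_sum: "(\<And>i. i \<in> F \<Longrightarrow> f i \<in> X) \<Longrightarrow> (\<lambda>x. \<Sum>i\<in>F. f i x) \<in> X"
  by (induction F rule: infinite_finite_induct) (auto intro: X_zero X_add)

lemma X_representative:
  assumes "f \<in> closed_span lebesgue S"
  obtains g where "g \<in> X" "AE x in lebesgue. g x = f x"
  using fs assms unfolding function_space_of_def by blast

lemma reproducing: "u \<in> X \<Longrightarrow> u t = ip u (\<lambda>s. k s t)"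
  using rk by (auto simp: reproducing_kernel_def)

text \<open>Cauchy-Schwarz against the kernel section at \<open>t\<close>. Norm convergence in
  \<open>X\<close> therefore implies convergence at every point, not just almost everywhere.\<close>

lemma cmod_le_nrm: "u \<in> X \<Longrightarrow> cmod (u t) \<le> nrm u * nrm (\<lambda>s. k s t)"
  using L2_Cauchy_Schwarz[OF X_L2 X_L2[OF X_kernel], of u t] by (simp flip: reproducing)

lemma X_eq_of_nrm:
  assumes "u \<in> X" "v \<in> X" "nrm (\<lambda>x. u x - v x) = 0"
  shows "u = v"
proof
  fix t show "u t = v t"
    using cmod_le_nrm[OF X_diff[OF assms(1,2)], of t] assms(3) by simp
qed

text \<open>This leaves at most one candidate for the definite description in
  \<open>impulse_response_in\<close>.\<close>

lemma X_eq_of_AE: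
  assumes "u \<in> X" "v \<in> X" "AE x in lebesgue. u x = v x"
  shows "u = v"
proof (rule X_eq_of_nrm[OF assms(1,2)])
  have "nrm (\<lambda>x. u x - v x) = nrm (\<lambda>x. 0)"
    using X_L2[OF X_diff[OF assms(1,2)]] assms(3)
    by (intro L2_norm_cong_AE) (auto intro: L2_measurable)
  then show "nrm (\<lambda>x. u x - v x) = 0" by (simp add: L2_norm_def)
qed

section \<open>Closedness, completeness and convergent series in \<open>X\<close>\<close>

lemma closed_span_closed:
  assumes "f \<in> L2 lebesgue" "\<And>e. e > 0 \<Longrightarrow> \<exists>v\<in>closed_span lebesgue S. nrm (\<lambda>x. f x - v x) < e"
  shows "f \<in> closed_span lebesgue S"
  unfolding closed_span_def
proof (intro CollectI conjI allI impI assms(1))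
  fix e :: real assume "e > 0"
  then have e: "e / 2 > 0" by simp
  obtain v where v: "v \<in> closed_span lebesgue S" "nrm (\<lambda>x. f x - v x) < e / 2"
    using assms(2)[OF e] by auto
  then obtain g where g: "g \<in> lin_span S" "nrm (\<lambda>x. v x - g x) < e / 2"
    using e unfolding closed_span_def mem_Collect_eq by meson
  have "nrm (\<lambda>x. f x - g x) < e"
    using L2_dist_triangle[of f lebesgue v g] assms(1) v g lin_span_L2[OF g(1)]
    by (auto simp: closed_span_def)
  then show "\<exists>g\<in>lin_span S. nrm (\<lambda>x. f x - g x) < e" using g(1) by auto
qed

text \<open>Point evaluations are continuous, so a Cauchy sequence converges pointwise; by Fatou's lemma
  its pointwise limit is also the limit in norm, and it equals its own representative in \<open>X\<close>.\<close>

lemma X_complete: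
  assumes u: "\<And>n::nat. u n \<in> X"
    and Cauchy: "\<And>e. e > 0 \<Longrightarrow> \<exists>N. \<forall>m\<ge>N. \<forall>n\<ge>N. nrm (\<lambda>x. u m x - u n x) \<le> e"
  obtains v where "v \<in> X" "(\<lambda>n. nrm (\<lambda>x. u n x - v x)) \<longlonglongrightarrow> 0"
proof -
  have "convergent (\<lambda>n. u n x)" for x
  proof (rule Cauchy_convergent, rule metric_CauchyI)
    fix e :: real assume e: "e > 0"
    \<comment> \<open>The added 1 keeps \<open>K\<close> positive, so that it can be divided by even
      when the kernel section at \<open>x\<close> has norm 0.\<close>
    define K where "K = nrm (\<lambda>s. k s x) + 1"
    have K: "K > 0" "nrm (\<lambda>s. k s x) \<le> K" by (simp_all add: K_def add_nonneg_pos)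
    obtain N where N: "nrm (\<lambda>x. u m x - u n x) \<le> e / 2 / K" if "m \<ge> N" "n \<ge> N" for m n
      using Cauchy[of "e / 2 / K"] e K by fastforce
    have "dist (u m x) (u n x) < e" if "m \<ge> N" "n \<ge> N" for m n
    proof -
      have "dist (u m x) (u n x) \<le> nrm (\<lambda>x. u m x - u n x) * nrm (\<lambda>s. k s x)"
        using cmod_le_nrm[OF X_diff[OF u[of m] u[of n]], of x] by (simp add: dist_norm)
      also have "\<dots> \<le> e / 2 / K * K"
        using e K by (intro mult_mono N that) auto
      also have "\<dots> < e" using e K by simp
      finally show ?thesis .
    qed
    then show "\<exists>N. \<forall>m\<ge>N. \<forall>n\<ge>N. dist (u m x) (u n x) < e" by blast
  qed
  then obtain f where f: "(\<lambda>n. u n x) \<longlonglongrightarrow> f x" for x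
    unfolding convergent_def by metis
  have [measurable]: "u n \<in> borel_measurable lebesgue" for n
    using X_L2[OF u] by (auto intro: L2_measurable)
  have f_meas: "f \<in> borel_measurable lebesgue"
    by (rule borel_measurable_LIMSEQ_metric[of u]) (use f in auto)
  \<comment> \<open>For fixed \<open>n\<close> the differences u m - u n converge pointwise to f - u
    n, and the Cauchy bound survives the limit by Fatou's lemma.\<close>
  have close: "(\<lambda>x. f x - u n x) \<in> L2 lebesgue" "nrm (\<lambda>x. f x - u n x) \<le> e"
    if "\<And>m. m \<ge> N \<Longrightarrow> nrm (\<lambda>x. u m x - u n x) \<le> e" for e n N
    by (rule L2_norm_le_liminf_pointwise[where u = "\<lambda>m x. u m x - u n x" and N = N and e = e];
        use that f f_meas in \<open>auto intro!: X_L2 X_diff u tendsto_intros borel_measurable_diff\<close>)+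
  have lim: "\<exists>N. \<forall>n\<ge>N. (\<lambda>x. f x - u n x) \<in> L2 lebesgue \<and> nrm (\<lambda>x. f x - u n x) \<le> e"
    if e: "e > 0" for e
  proof -
    obtain N where "\<forall>m\<ge>N. \<forall>n\<ge>N. nrm (\<lambda>x. u m x - u n x) \<le> e"
      using Cauchy[OF e] by blast
    then show ?thesis using close[of N _ e] by blast
  qed
  obtain n where "(\<lambda>x. f x - u n x) \<in> L2 lebesgue"
    using lim[of 1] by auto
  then have fL2: "f \<in> L2 lebesgue"
    using L2_add[of "\<lambda>x. f x - u n x" lebesgue "u n"] X_L2[OF u[of n]] by simp
  have "f \<in> closed_span lebesgue S"
  proof (rule closed_span_closed[OF fL2])
    fix e :: real assume "e > 0"
    then obtain N where "nrm (\<lambda>x. f x - u N x) \<le> e / 2"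
      using lim[of "e / 2"] by auto
    then show "\<exists>v\<in>closed_span lebesgue S. nrm (\<lambda>x. f x - v x) < e"
      using X_subset[OF u[of N]] \<open>e > 0\<close> by (intro bexI[of _ "u N"]) auto
  qed
  then obtain v where v: "v \<in> X" "AE x in lebesgue. v x = f x"
    by (rule X_representative)
  have "nrm (\<lambda>x. u n x - v x) = nrm (\<lambda>x. f x - u n x)" for n
    unfolding L2_norm_minus_commute[of _ "u n" v]
    using v(2) L2_measurable[OF X_L2[OF v(1)]] f_meas
    by (intro L2_norm_cong_AE borel_measurable_diff) auto
  moreover have "(\<lambda>n. nrm (\<lambda>x. f x - u n x)) \<longlonglongrightarrow> 0"
  proof (rule LIMSEQ_I)
    fix e :: real assume "e > 0"
    then obtain N where "\<forall>n\<ge>N. nrm (\<lambda>x. f x - u n x) \<le> e / 2"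
      using lim[of "e / 2"] by auto
    then show "\<exists>N. \<forall>n\<ge>N. norm (nrm (\<lambda>x. f x - u n x) - 0) < e"
      using \<open>e > 0\<close> by (intro exI[of _ N]) (auto intro: le_less_trans)
  qed
  ultimately show thesis by (intro that[OF v(1)]) simp
qed

text \<open>Pairing with \<open>w\<close> is continuous with constant \<open>nrm w\<close>, so it
  may be applied termwise. A kernel section for \<open>w\<close> yields pointwise sums, a general
  \<open>w\<close> the sesquilinear form of the frame operator.\<close>

lemma has_sum_of_L2_has_sum:
  assumes "\<And>i. f i \<in> X" "u \<in> X" "L2_has_sum lebesgue f u" "w \<in> X"
  shows "((\<lambda>i. ip (f i) w) has_sum ip u w) UNIV"
  unfolding has_sum_def
proof (rule Lim_transform2)
  show "((\<lambda>F. ip u w) \<longlongrightarrow> ip u w) (finite_subsets_at_top UNIV)" by simp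
  have "((\<lambda>F. nrm (\<lambda>x. u x - (\<Sum>i\<in>F. f i x)) * nrm w) \<longlongrightarrow> 0) (finite_subsets_at_top UNIV)"
    using assms(3) unfolding L2_has_sum_def by (rule tendsto_mult_left_zero)
  then show "((\<lambda>F. ip u w - (\<Sum>i\<in>F. ip (f i) w)) \<longlongrightarrow> 0) (finite_subsets_at_top UNIV)"
  proof (rule Lim_null_comparison[rotated], intro always_eventually allI)
    fix F
    have "ip u w - (\<Sum>i\<in>F. ip (f i) w) = ip (\<lambda>x. u x - (\<Sum>i\<in>F. f i x)) w"
      using assms by (simp add: L2_inner_diff_left L2_inner_sum_left X_L2 X_sum)
    then show "norm (ip u w - (\<Sum>i\<in>F. ip (f i) w)) \<le> nrm (\<lambda>x. u x - (\<Sum>i\<in>F. f i x)) * nrm w"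
      using assms by (simp add: L2_Cauchy_Schwarz X_L2 X_sum X_diff)
  qed
qed

lemma pointwise_has_sum:
  assumes "\<And>i. f i \<in> X" "u \<in> X" "L2_has_sum lebesgue f u"
  shows "((\<lambda>i. f i x) has_sum u x) UNIV"
  using has_sum_of_L2_has_sum[OF assms X_kernel[of x]] assms by (simp flip: reproducing)

end

section \<open>Frames and their canonical duals\<close>

lemma has_sum_finite_tail:
  fixes a :: "'i \<Rightarrow> real"
  assumes "(a has_sum s) UNIV" "\<And>i. 0 \<le> a i"
  shows "finite F \<Longrightarrow> sum a F \<le> s"
    and "finite F \<Longrightarrow> finite G \<Longrightarrow> sum a (G - F) \<le> s - sum a F"
proof -
  show *: "sum a F \<le> s" if "finite F" for F
    by (rule has_sum_mono_neutral[OF has_sum_finite[OF that] assms(1)]) (use assms(2) in auto)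
  show "sum a (G - F) \<le> s - sum a F" if "finite F" "finite G"
    using *[of "F \<union> G"] that sum.union_disjoint[of F "G - F" a] by simp
qed

locale rkhs_frame = rkhs +
  fixes f :: "'i \<Rightarrow> real \<Rightarrow> complex" and A B :: real
  assumes frame: "frame_bounds X f A B"
begin

lemma A_pos: "A > 0" and B_pos: "B > 0" and f_X: "f i \<in> X"
  using frame by (auto simp: frame_bounds_def)

lemma f_L2: "f i \<in> L2 lebesgue"
  by (rule X_L2[OF f_X])

section \<open>Analysis and synthesis for one frame\<close>

definition energy :: "(real \<Rightarrow> complex) \<Rightarrow> real" where
  "energy u = (\<Sum>\<^sub>\<infinity>i. (cmod (ip u (f i)))\<^sup>2)"

lemma energy_has_sum: "u \<in> X \<Longrightarrow> ((\<lambda>i. (cmod (ip u (f i)))\<^sup>2) has_sum energy u) UNIV"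
  and energy_lower: "u \<in> X \<Longrightarrow> A * (nrm u)\<^sup>2 \<le> energy u"
  and energy_upper: "u \<in> X \<Longrightarrow> energy u \<le> B * (nrm u)\<^sup>2"
  using frame by (auto simp: frame_bounds_def energy_def)

text \<open>Synthesis is adjoint to analysis and inherits its bound: pairing the combination with
  itself and using Cauchy-Schwarz for finite sums bounds the fourth power of its norm by B times the
  coefficient sum times its squared norm, and one factor cancels.\<close>

lemma Bessel:
  assumes "finite F"
  shows "(nrm (\<lambda>x. \<Sum>i\<in>F. c i * f i x))\<^sup>2 \<le> B * (\<Sum>i\<in>F. (cmod (c i))\<^sup>2)"
proof -
  define v where "v = (\<lambda>x. \<Sum>i\<in>F. c i * f i x)"
  have v: "v \<in> X" unfolding v_def by (intro X_sum X_scale f_X)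
  have "complex_of_real ((nrm v)\<^sup>2) = ip v v" by (rule L2_inner_self[symmetric])
  also have "\<dots> = (\<Sum>i\<in>F. c i * ip (f i) v)"
    using L2_inner_sum_left[of F "\<lambda>i x. c i * f i x" lebesgue v]
    by (simp add: L2_scale f_L2 X_L2 v L2_inner_scale_left flip: v_def)
  finally have "(nrm v)\<^sup>2 = cmod (\<Sum>i\<in>F. c i * ip (f i) v)"
    by (metis norm_of_real abs_of_nonneg zero_le_power2)
  also have "\<dots> \<le> (\<Sum>i\<in>F. cmod (c i) * cmod (ip v (f i)))"
    by (rule order_trans[OF norm_sum]) (subst L2_inner_commute, simp add: norm_mult)
  finally have "((nrm v)\<^sup>2)\<^sup>2 \<le> (\<Sum>i\<in>F. cmod (c i) * cmod (ip v (f i)))\<^sup>2"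
    by (rule power_mono) simp
  also have "\<dots> \<le> (\<Sum>i\<in>F. (cmod (c i))\<^sup>2) * (\<Sum>i\<in>F. (cmod (ip v (f i)))\<^sup>2)"
    by (rule Cauchy_Schwarz_ineq_sum)
  also have "\<dots> \<le> (\<Sum>i\<in>F. (cmod (c i))\<^sup>2) * (B * (nrm v)\<^sup>2)"
    using has_sum_finite_tail(1)[OF energy_has_sum[OF v] _ assms] energy_upper[OF v]
    by (intro mult_left_mono) (auto intro: sum_nonneg order_trans)
  finally have "(nrm v)\<^sup>2 * (nrm v)\<^sup>2 \<le> (B * (\<Sum>i\<in>F. (cmod (c i))\<^sup>2)) * (nrm v)\<^sup>2"
    by (simp add: power2_eq_square mult_ac)
  then have "(nrm v)\<^sup>2 \<le> B * (\<Sum>i\<in>F. (cmod (c i))\<^sup>2)"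
    using B_pos by (cases "nrm v = 0") (simp add: sum_nonneg, simp only: mult_le_cancel_right, simp)
  then show ?thesis by (simp add: v_def)
qed

text \<open>Bessel's inequality on tails makes the partial sums a Cauchy net. Since
  \<open>X_complete\<close> speaks of sequences, a sequence of finite sets is extracted, and its
  limit is then compared with all finite partial sums.\<close>

lemma synthesis:
  assumes c: "((\<lambda>i. (cmod (c i))\<^sup>2) has_sum s) UNIV"
  obtains v where "v \<in> X" "L2_has_sum lebesgue (\<lambda>i x. c i * f i x) v" "(nrm v)\<^sup>2 \<le> B * s"
proof -
  define p where "p F = (\<lambda>x. \<Sum>i\<in>F. c i * f i x)" for F
  \<comment> \<open>Bessel bound for the part of the series outside \<open>F\<close>; it dominates
    the change caused by any finite enlargement of \<open>F\<close>.\<close>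
  define d where "d F = sqrt (B * (s - (\<Sum>i\<in>F. (cmod (c i))\<^sup>2)))" for F
  have pX: "p F \<in> X" for F
    unfolding p_def by (intro X_sum X_scale f_X)
  have step: "nrm (\<lambda>x. p (F \<union> G) x - p F x) \<le> d F" if "finite F" "finite G" for F G
  proof -
    have "p (F \<union> G) x - p F x = p (G - F) x" for x
      unfolding p_def using that sum.union_disjoint[of F "G - F" "\<lambda>i. c i * f i x"] by simp
    then have "(nrm (\<lambda>x. p (F \<union> G) x - p F x))\<^sup>2 \<le> B * (\<Sum>i\<in>G - F. (cmod (c i))\<^sup>2)"
      using Bessel[of "G - F" c] that by (simp add: p_def)
    also have "\<dots> \<le> B * (s - (\<Sum>i\<in>F. (cmod (c i))\<^sup>2))"
      using B_pos that has_sum_finite_tail(2)[OF c] by (intro mult_left_mono) auto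
    finally show ?thesis unfolding d_def by (rule real_le_rsqrt)
  qed
  \<comment> \<open>The two sets need not be nested, so both are compared with their union.\<close>
  have dist: "nrm (\<lambda>x. p F x - p G x) \<le> d F + d G" if "finite F" "finite G" for F G
    using L2_dist_triangle[OF X_L2[OF pX[of F]] X_L2[OF pX[of "F \<union> G"]] X_L2[OF pX[of G]]]
      step[OF that] step[OF that(2,1)] L2_norm_minus_commute[of lebesgue "p F" "p (F \<union> G)"]
    by (simp add: Un_commute)
  have "((\<lambda>F. sqrt (B * (s - (\<Sum>i\<in>F. (cmod (c i))\<^sup>2)))) \<longlongrightarrow> sqrt (B * (s - s)))
      (finite_subsets_at_top UNIV)"
    using c unfolding has_sum_def by (intro tendsto_intros)
  then have d0: "(d \<longlongrightarrow> 0) (finite_subsets_at_top UNIV)"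
    by (simp add: d_def[abs_def])
  have "\<exists>F. finite F \<and> d F < inverse (real (Suc n))" for n
  proof -
    have "eventually (\<lambda>F. d F < inverse (real (Suc n))) (finite_subsets_at_top UNIV)"
      by (rule order_tendstoD(2)[OF d0]) simp
    then show ?thesis unfolding eventually_finite_subsets_at_top by auto
  qed
  then obtain F where F: "finite (F n)" "d (F n) < inverse (real (Suc n))" for n
    by metis
  have dF: "(\<lambda>n. d (F n)) \<longlonglongrightarrow> 0"
  proof (rule tendsto_sandwich[OF _ _ tendsto_const LIMSEQ_inverse_real_of_nat])
    have "0 \<le> d (F n)" for n
      using step[OF F(1)[of n] F(1)[of n]] L2_norm_nonneg order_trans by blast
    then show "eventually (\<lambda>n. 0 \<le> d (F n)) sequentially" by simp
    show "eventually (\<lambda>n. d (F n) \<le> inverse (real (Suc n))) sequentially"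
      using F(2) less_imp_le by (intro always_eventually) blast
  qed
  obtain v where v: "v \<in> X" "(\<lambda>n. nrm (\<lambda>x. p (F n) x - v x)) \<longlonglongrightarrow> 0"
  proof (rule X_complete[of "\<lambda>n. p (F n)"])
    fix e :: real assume e: "e > 0"
    have "eventually (\<lambda>n. d (F n) < e / 2) sequentially"
      by (rule order_tendstoD(2)[OF dF]) (use e in simp)
    then obtain N where "d (F n) < e / 2" if "n \<ge> N" for n
      unfolding eventually_sequentially by blast
    then show "\<exists>N. \<forall>m\<ge>N. \<forall>n\<ge>N. nrm (\<lambda>x. p (F m) x - p (F n) x) \<le> e"
      using dist[OF F(1) F(1)] by (intro exI[of _ N]) (smt (verit) field_sum_of_halves)
  qed (use pX in auto)
  have close: "nrm (\<lambda>x. v x - p G x) \<le> d G" if "finite G" for G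
  proof (rule LIMSEQ_le_const)
    show "(\<lambda>n. nrm (\<lambda>x. p (F n) x - v x) + (d (F n) + d G)) \<longlonglongrightarrow> d G"
      using tendsto_add[OF v(2) tendsto_add[OF dF tendsto_const[of "d G"]]] by simp
    have "nrm (\<lambda>x. v x - p G x) \<le> nrm (\<lambda>x. p (F n) x - v x) + (d (F n) + d G)" for n
      using L2_dist_triangle[OF X_L2[OF v(1)] X_L2[OF pX[of "F n"]] X_L2[OF pX[of G]]]
        dist[OF F(1)[of n] that] L2_norm_minus_commute[of lebesgue "p (F n)" v] by simp
    then show "\<exists>N. \<forall>n\<ge>N. nrm (\<lambda>x. v x - p G x) \<le> nrm (\<lambda>x. p (F n) x - v x) + (d (F n) + d G)"
      by auto
  qed
  have "L2_has_sum lebesgue (\<lambda>i x. c i * f i x) v"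
    unfolding L2_has_sum_def
  proof (rule tendsto_sandwich[OF _ _ tendsto_const d0])
    show "\<forall>\<^sub>F F in finite_subsets_at_top UNIV. nrm (\<lambda>x. v x - (\<Sum>i\<in>F. c i * f i x)) \<le> d F"
      using close by (auto simp: p_def intro: eventually_finite_subsets_at_top_weakI)
  qed auto
  \<comment> \<open>The empty set has partial sum 0 and tail bound sqrt (B * s).\<close>
  moreover have "nrm v \<le> sqrt (B * s)"
    using close[of "{}"] by (simp add: p_def d_def)
  then have "(nrm v)\<^sup>2 \<le> (sqrt (B * s))\<^sup>2" by (rule power_mono) simp
  then have "(nrm v)\<^sup>2 \<le> B * s"
    using B_pos has_sum_finite_tail(1)[OF c, of "{}"] by simp
  ultimately show thesis using that v(1) by blast
qed

text \<open>Pointwise summation gives a total function without choosing a limit. For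
  \<open>u\<close> in \<open>X\<close> the next lemma identifies it with the norm limit.\<close>

definition frame_op :: "(real \<Rightarrow> complex) \<Rightarrow> real \<Rightarrow> complex" where
  "frame_op u = (\<lambda>x. \<Sum>\<^sub>\<infinity>i. ip u (f i) * f i x)"

text \<open>The estimate by \<open>energy u\<close> implies boundedness by \<open>B\<close>, but it
  is this stronger form that drives the contraction in \<open>residual_step\<close>.\<close>

lemma frame_op:
  assumes "u \<in> X"
  shows frame_op_X: "frame_op u \<in> X"
    and frame_op_has_sum: "L2_has_sum lebesgue (\<lambda>i x. ip u (f i) * f i x) (frame_op u)"
    and nrm_frame_op_energy: "(nrm (frame_op u))\<^sup>2 \<le> B * energy u"
proof -
  obtain v where v: "v \<in> X" "L2_has_sum lebesgue (\<lambda>i x. ip u (f i) * f i x) v"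
    "(nrm v)\<^sup>2 \<le> B * energy u"
    using synthesis[OF energy_has_sum[OF assms]] by blast
  have "frame_op u = v"
    unfolding frame_op_def
    by (intro ext infsumI pointwise_has_sum X_scale f_X v)
  then show "frame_op u \<in> X" "L2_has_sum lebesgue (\<lambda>i x. ip u (f i) * f i x) (frame_op u)"
    "(nrm (frame_op u))\<^sup>2 \<le> B * energy u"
    using v by auto
qed

lemma ip_frame_op:
  assumes "u \<in> X" "w \<in> X"
  shows "((\<lambda>i. ip u (f i) * cnj (ip w (f i))) has_sum ip (frame_op u) w) UNIV"
  using has_sum_of_L2_has_sum[OF X_scale[OF f_X] frame_op_X[OF assms(1)] frame_op_has_sum[OF assms(1)] assms(2)]
  unfolding L2_inner_scale_left L2_inner_commute[of lebesgue "f _" w] .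

text \<open>Both sides are sums of the same series, one of them after conjugation.\<close>

lemma frame_op_selfadjoint:
  assumes "u \<in> X" "w \<in> X"
  shows "ip (frame_op u) w = ip u (frame_op w)"
proof -
  have "((\<lambda>i. cnj (ip w (f i) * cnj (ip u (f i)))) has_sum cnj (ip (frame_op w) u)) UNIV"
    unfolding has_sum_cnj_iff by (rule ip_frame_op[OF assms(2,1)])
  then have "((\<lambda>i. ip u (f i) * cnj (ip w (f i))) has_sum ip u (frame_op w)) UNIV"
    by (simp add: mult.commute flip: L2_inner_commute)
  with ip_frame_op[OF assms] show ?thesis by (rule has_sum_unique)
qed

lemma ip_frame_op_self:
  assumes "u \<in> X"
  shows "ip (frame_op u) u = complex_of_real (energy u)"
proof (rule has_sum_unique[OF ip_frame_op[OF assms assms]])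
  have "((\<lambda>i. complex_of_real ((cmod (ip u (f i)))\<^sup>2)) has_sum complex_of_real (energy u)) UNIV"
    using energy_has_sum[OF assms] by (rule has_sum_of_real)
  then show "((\<lambda>i. ip u (f i) * cnj (ip u (f i))) has_sum complex_of_real (energy u)) UNIV"
    by (simp only: of_real_power complex_norm_square [symmetric])
qed

lemma frame_op_pointwise: "u \<in> X \<Longrightarrow> ((\<lambda>i. ip u (f i) * f i x) has_sum frame_op u x) UNIV"
  by (rule pointwise_has_sum) (auto intro: X_scale f_X frame_op)

lemma frame_op_add:
  assumes "u \<in> X" "v \<in> X"
  shows "frame_op (\<lambda>x. u x + v x) = (\<lambda>x. frame_op u x + frame_op v x)"
proof
  fix x
  have "((\<lambda>i. ip u (f i) * f i x + ip v (f i) * f i x) has_sum (frame_op u x + frame_op v x)) UNIV"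
    by (intro has_sum_add frame_op_pointwise assms)
  then show "frame_op (\<lambda>x. u x + v x) x = frame_op u x + frame_op v x"
    using has_sum_unique[OF frame_op_pointwise[OF X_add[OF assms], of x]] assms
    by (simp add: L2_inner_add_left X_L2 f_L2 ring_distribs)
qed

lemma frame_op_scale: "frame_op (\<lambda>x. a * u x) = (\<lambda>x. a * frame_op u x)"
  by (simp add: frame_op_def L2_inner_scale_left mult.assoc infsum_cmult_right')

lemma frame_op_diff:
  assumes "u \<in> X" "v \<in> X"
  shows "frame_op (\<lambda>x. u x - v x) = (\<lambda>x. frame_op u x - frame_op v x)"
  using frame_op_add[OF assms(1) X_scale[OF assms(2), of "-1"]] frame_op_scale[of "-1" v] by simp

lemma nrm_frame_op_upper:
  assumes "u \<in> X"
  shows "nrm (frame_op u) \<le> B * nrm u"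
proof (rule power2_le_imp_le)
  have "(nrm (frame_op u))\<^sup>2 \<le> B * energy u" by (rule nrm_frame_op_energy[OF assms])
  also have "\<dots> \<le> B * (B * (nrm u)\<^sup>2)"
    using B_pos energy_upper[OF assms] by (intro mult_left_mono) auto
  finally show "(nrm (frame_op u))\<^sup>2 \<le> (B * nrm u)\<^sup>2"
    by (simp add: power2_eq_square mult_ac)
qed (use B_pos in simp)

text \<open>Coercivity of the quadratic form of \<open>frame_op\<close> (lower frame bound) followed
  by Cauchy-Schwarz. It converts control of residuals into control of preimages.\<close>

lemma nrm_frame_op_lower:
  assumes "u \<in> X"
  shows "A * nrm u \<le> nrm (frame_op u)"
proof (cases "nrm u = 0")
  case False
  then have pos: "nrm u > 0" using L2_norm_nonneg[of lebesgue u] by linarith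
  have "A * (nrm u)\<^sup>2 \<le> energy u" by (rule energy_lower[OF assms])
  also have "\<dots> = Re (ip (frame_op u) u)" by (simp add: ip_frame_op_self[OF assms])
  also have "\<dots> \<le> nrm (frame_op u) * nrm u"
    using L2_Cauchy_Schwarz[OF X_L2[OF frame_op_X[OF assms]] X_L2[OF assms]]
      complex_Re_le_cmod order_trans by blast
  finally have "(A * nrm u) * nrm u \<le> nrm (frame_op u) * nrm u"
    by (simp add: power2_eq_square mult_ac)
  then show ?thesis using pos by simp
qed simp

section \<open>Inversion of the frame operator\<close>

text \<open>One step of the Richardson iteration for \<open>frame_op w = v\<close> contracts the residual, because
  \<open>nrm (frame_op r)\<^sup>2 \<le> B * energy r\<close>.\<close>

lemma residual_step:
  assumes "r \<in> X"
  shows "(nrm (\<lambda>x. r x - 1 / B * frame_op r x))\<^sup>2 \<le> (1 - A / B) * (nrm r)\<^sup>2"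
proof -
  let ?b = "complex_of_real (- 1 / B)"
  have B: "B > 0" by (rule B_pos)
  have "ip r (\<lambda>x. ?b * frame_op r x) = ?b * complex_of_real (energy r)"
    by (subst L2_inner_scale_right, subst frame_op_selfadjoint[symmetric, OF assms assms])
      (simp add: ip_frame_op_self[OF assms])
  then have ip: "Re (ip r (\<lambda>x. ?b * frame_op r x)) = - energy r / B" by simp
  have nb: "cmod ?b = 1 / B" unfolding norm_of_real using B by simp
  have "(nrm (\<lambda>x. r x + ?b * frame_op r x))\<^sup>2 =
      (nrm r)\<^sup>2 - 2 * energy r / B + (nrm (frame_op r))\<^sup>2 / B\<^sup>2"
    by (subst L2_norm_add_power2)
      (use assms in \<open>simp_all only: X_L2 X_scale frame_op_X ip L2_norm_scale nb\<close>,
        simp add: power_mult_distrib power_divide)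
  \<comment> \<open>Half of the linear gain 2 * energy / B absorbs the quadratic term; the other
    half is estimated by the lower frame bound.\<close>
  also have "\<dots> \<le> (nrm r)\<^sup>2 - 2 * energy r / B + B * energy r / B\<^sup>2"
    using nrm_frame_op_energy[OF assms] B by (simp add: divide_right_mono)
  also have "\<dots> = (nrm r)\<^sup>2 - energy r / B"
    using B by (simp add: power2_eq_square)
  also have "\<dots> \<le> (nrm r)\<^sup>2 - A * (nrm r)\<^sup>2 / B"
    using energy_lower[OF assms] B by (simp add: divide_right_mono)
  finally show ?thesis by (simp add: algebra_simps)
qed

text \<open>Richardson iteration from 0 with step 1/B makes the residuals decay geometrically. As
  \<open>frame_op\<close> maps differences of iterates to differences of residuals,
  \<open>nrm_frame_op_lower\<close> turns this decay into the Cauchy property of the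
  iterates.\<close>

lemma frame_op_surj:
  assumes v: "v \<in> X"
  obtains w where "w \<in> X" "frame_op w = v"
proof -
  define u where "u = rec_nat (\<lambda>x. 0) (\<lambda>_ u x. u x + 1 / B * (v x - frame_op u x))"
  define r where "r n = (\<lambda>x. v x - frame_op (u n) x)" for n
  have uX: "u n \<in> X" for n
  proof (induction n)
    case (Suc n)
    then have "(\<lambda>x. u n x + 1 / B * (v x - frame_op (u n) x)) \<in> X"
      by (intro X_add X_scale X_diff v frame_op_X)
    then show ?case by (simp add: u_def)
  qed (simp add: u_def X_zero)
  have rX: "r n \<in> X" for n
    unfolding r_def by (intro X_diff v frame_op_X uX)
  have u_Suc: "u (Suc n) = (\<lambda>x. u n x + 1 / B * r n x)" for n
    by (simp add: u_def r_def)
  have r_Suc: "r (Suc n) = (\<lambda>x. r n x - 1 / B * frame_op (r n) x)" for n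
    unfolding r_def[of "Suc n"] u_Suc
    by (subst frame_op_add[OF uX X_scale[OF rX]], subst frame_op_scale) (simp add: r_def algebra_simps)
  \<comment> \<open>On the zero space the frame inequalities do not force A <= B, so 1 - A / B may
    be negative; the maximum keeps the rate nonnegative.\<close>
  define q where "q = max 0 (1 - A / B)"
  have q: "0 \<le> q" "q < 1" using A_pos B_pos by (auto simp: q_def)
  have bound: "(nrm (r n))\<^sup>2 \<le> q ^ n * (nrm v)\<^sup>2" for n
  proof (induction n)
    case 0
    have "ip (\<lambda>x. 0) w = 0" for w by (simp add: L2_inner_def)
    then show ?case by (simp add: r_def u_def frame_op_def)
  next
    case (Suc n)
    have "(nrm (r (Suc n)))\<^sup>2 \<le> (1 - A / B) * (nrm (r n))\<^sup>2"
      unfolding r_Suc by (rule residual_step[OF rX])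
    also have "\<dots> \<le> q * (q ^ n * (nrm v)\<^sup>2)"
      by (intro mult_mono Suc) (auto simp: q_def)
    finally show ?case by (simp add: mult_ac)
  qed
  have lim: "(\<lambda>n. q ^ n * (nrm v)\<^sup>2) \<longlonglongrightarrow> 0"
    using q by (intro tendsto_mult_left_zero LIMSEQ_power_zero) auto
  have "(\<lambda>n. (nrm (r n))\<^sup>2) \<longlonglongrightarrow> 0"
    by (rule tendsto_sandwich[OF _ _ tendsto_const lim]) (use bound in auto)
  then have "(\<lambda>n. sqrt ((nrm (r n))\<^sup>2)) \<longlonglongrightarrow> sqrt 0" by (rule tendsto_real_sqrt)
  then have r0: "(\<lambda>n. nrm (r n)) \<longlonglongrightarrow> 0"
    unfolding real_sqrt_zero real_sqrt_abs abs_of_nonneg[OF L2_norm_nonneg] .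
  obtain w where w: "w \<in> X" "(\<lambda>n. nrm (\<lambda>x. u n x - w x)) \<longlonglongrightarrow> 0"
  proof (rule X_complete[of u])
    fix e :: real assume e: "e > 0"
    \<comment> \<open>The factor \<open>A\<close> anticipates the division by \<open>A\<close> in
      the lower bound for \<open>frame_op\<close>.\<close>
    have "eventually (\<lambda>n. nrm (r n) < A * e / 2) sequentially"
      by (rule order_tendstoD(2)[OF r0]) (use e A_pos in simp)
    then obtain N where N: "nrm (r n) < A * e / 2" if "n \<ge> N" for n
      unfolding eventually_sequentially by blast
    have "nrm (\<lambda>x. u m x - u n x) \<le> e" if "m \<ge> N" "n \<ge> N" for m n
    proof -
      have "A * nrm (\<lambda>x. u m x - u n x) \<le> nrm (frame_op (\<lambda>x. u m x - u n x))"
        by (intro nrm_frame_op_lower X_diff uX)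
      also have "frame_op (\<lambda>x. u m x - u n x) = (\<lambda>x. r n x + - 1 * r m x)"
        by (simp add: frame_op_diff uX r_def)
      also have "nrm \<dots> \<le> nrm (r n) + nrm (r m)"
        using L2_norm_triangle[OF X_L2[OF rX[of n]] X_L2[OF X_scale[OF rX[of m], of "-1"]]]
        by (simp only: L2_norm_scale) simp
      also have "\<dots> \<le> A * e" using N[OF that(1)] N[OF that(2)] by simp
      finally show ?thesis using A_pos by simp
    qed
    then show "\<exists>N. \<forall>m\<ge>N. \<forall>n\<ge>N. nrm (\<lambda>x. u m x - u n x) \<le> e" by blast
  qed (rule uX)
  have "nrm (\<lambda>x. frame_op w x - v x) \<le> 0"
  proof (rule LIMSEQ_le_const)
    show "(\<lambda>n. B * nrm (\<lambda>x. u n x - w x) + nrm (r n)) \<longlonglongrightarrow> 0"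
      using tendsto_add[OF tendsto_mult_right_zero[OF w(2), of B] r0] by simp
    have "nrm (\<lambda>x. frame_op w x - v x) \<le> B * nrm (\<lambda>x. u n x - w x) + nrm (r n)" for n
    proof -
      have "nrm (\<lambda>x. frame_op w x - v x) \<le>
          nrm (\<lambda>x. frame_op w x - frame_op (u n) x) + nrm (\<lambda>x. frame_op (u n) x - v x)"
        by (intro L2_dist_triangle X_L2 frame_op_X w uX v)
      also have "nrm (\<lambda>x. frame_op w x - frame_op (u n) x) \<le> B * nrm (\<lambda>x. u n x - w x)"
        using nrm_frame_op_upper[OF X_diff[OF uX[of n] w(1)]]
        by (simp add: frame_op_diff uX w L2_norm_minus_commute[of _ "frame_op w"])
      finally show ?thesis
        by (simp add: r_def L2_norm_minus_commute[of _ v])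
    qed
    then show "\<exists>N. \<forall>n\<ge>N. nrm (\<lambda>x. frame_op w x - v x) \<le> B * nrm (\<lambda>x. u n x - w x) + nrm (r n)"
      by auto
  qed
  then have "nrm (\<lambda>x. frame_op w x - v x) = 0"
    using L2_norm_nonneg order_antisym by blast
  then show thesis using that w(1) X_eq_of_nrm[OF frame_op_X[OF w(1)] v] by blast
qed

text \<open>The canonical dual consists of preimages of the frame elements under
  \<open>frame_op\<close>. Writing u = frame_op w turns the coefficients of u against the dual into
  those of w against the frame, by self-adjointness.\<close>

theorem dual_frame_exists: "\<exists>g. dual_frame X f g"
proof -
  have "\<exists>w. w \<in> X \<and> frame_op w = f i" for i
    by (rule frame_op_surj[OF f_X]) blast
  then obtain g where gX: "g i \<in> X" and g: "frame_op (g i) = f i" for i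
    by metis
  have ip_g: "ip (frame_op w) (g i) = ip w (f i)" if "w \<in> X" for w i
    by (simp add: frame_op_selfadjoint that gX g)
  \<comment> \<open>The constants combine the frame inequalities for \<open>w\<close> with A * nrm w
    <= nrm u <= B * nrm w.\<close>
  have "frame_bounds X g (A / B\<^sup>2) (B / A\<^sup>2)"
    unfolding frame_bounds_def
  proof (intro conjI ballI allI gX)
    fix u assume "u \<in> X"
    then obtain w where w: "w \<in> X" "frame_op w = u" by (rule frame_op_surj)
    have eq: "(\<lambda>i. (cmod (ip u (g i)))\<^sup>2) = (\<lambda>i. (cmod (ip w (f i)))\<^sup>2)"
      by (simp add: ip_g w flip: w(2))
    show "(\<lambda>i. (cmod (ip u (g i)))\<^sup>2) summable_on UNIV"
      unfolding eq using energy_has_sum[OF w(1)] by (rule has_sum_imp_summable)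
    have "(nrm u)\<^sup>2 \<le> (B * nrm w)\<^sup>2"
      using nrm_frame_op_upper[OF w(1)] by (intro power_mono) (auto simp: w)
    then have "A / B\<^sup>2 * (nrm u)\<^sup>2 \<le> A * (nrm w)\<^sup>2"
      using A_pos B_pos by (simp add: field_simps power_mult_distrib)
    also have "\<dots> \<le> energy w" by (rule energy_lower[OF w(1)])
    finally show "A / B\<^sup>2 * (nrm u)\<^sup>2 \<le> (\<Sum>\<^sub>\<infinity>i. (cmod (ip u (g i)))\<^sup>2)"
      unfolding eq by (simp add: energy_def)
    have "(A * nrm w)\<^sup>2 \<le> (nrm u)\<^sup>2"
      using nrm_frame_op_lower[OF w(1)] A_pos by (intro power_mono) (auto simp: w)
    then have "B * (nrm w)\<^sup>2 \<le> B / A\<^sup>2 * (nrm u)\<^sup>2"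
      using A_pos B_pos by (simp add: field_simps power_mult_distrib)
    then have "energy w \<le> B / A\<^sup>2 * (nrm u)\<^sup>2"
      using energy_upper[OF w(1)] by (rule order_trans[rotated])
    then show "(\<Sum>\<^sub>\<infinity>i. (cmod (ip u (g i)))\<^sup>2) \<le> B / A\<^sup>2 * (nrm u)\<^sup>2"
      unfolding eq by (simp add: energy_def)
  qed (use A_pos B_pos in auto)
  moreover have "L2_has_sum lebesgue (\<lambda>i x. ip u (g i) * f i x) u" if "u \<in> X" for u
  proof -
    obtain w where w: "w \<in> X" "frame_op w = u" using \<open>u \<in> X\<close> by (rule frame_op_surj)
    then show ?thesis using frame_op_has_sum[OF w(1)] ip_g[OF w(1)] by simp
  qed
  moreover have "L2_has_sum lebesgue (\<lambda>i x. ip u (f i) * g i x) u" if u: "u \<in> X" for u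
    unfolding L2_has_sum_def
  proof (rule tendsto_sandwich[OF _ _ tendsto_const])
    \<comment> \<open>\<open>frame_op\<close> maps partial sums of the dual expansion of
      \<open>u\<close> to partial sums of the series for \<open>frame_op u\<close>; the lower bound
      for \<open>frame_op\<close> carries the convergence of the latter back.\<close>
    have sum: "frame_op (\<lambda>x. \<Sum>i\<in>F. ip u (f i) * g i x) = (\<lambda>x. \<Sum>i\<in>F. ip u (f i) * f i x)" for F
    proof (induction F rule: infinite_finite_induct)
      case (insert i F)
      then show ?case
        by (simp add: frame_op_add X_scale X_sum gX frame_op_scale g)
    qed (use frame_op_scale[of 0 u] in simp_all)
    have "nrm (\<lambda>x. u x - (\<Sum>i\<in>F. ip u (f i) * g i x)) \<le>
        nrm (\<lambda>x. frame_op u x - (\<Sum>i\<in>F. ip u (f i) * f i x)) / A" for F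
    proof -
      have sX: "(\<lambda>x. \<Sum>i\<in>F. ip u (f i) * g i x) \<in> X"
        by (intro X_sum X_scale gX)
      show ?thesis
        using nrm_frame_op_lower[OF X_diff[OF u sX]] A_pos
        unfolding frame_op_diff[OF u sX] sum by (simp add: le_divide_eq mult.commute)
    qed
    then show "\<forall>\<^sub>F F in finite_subsets_at_top UNIV. nrm (\<lambda>x. u x - (\<Sum>i\<in>F. ip u (f i) * g i x)) \<le>
        nrm (\<lambda>x. frame_op u x - (\<Sum>i\<in>F. ip u (f i) * f i x)) / A"
      by simp
    show "((\<lambda>F. nrm (\<lambda>x. frame_op u x - (\<Sum>i\<in>F. ip u (f i) * f i x)) / A) \<longlongrightarrow> 0)
        (finite_subsets_at_top UNIV)"
      using frame_op_has_sum[OF u] unfolding L2_has_sum_def by (rule tendsto_divide_zero)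
  qed simp
  ultimately show ?thesis
    unfolding dual_frame_def is_frame_def by blast
qed

end

section \<open>Lebesgue measure on the plane\<close>

text \<open>Lebesgue measure is complete, so preimages that agree almost everywhere are measurable
  together.\<close>

lemma lebesgue_measurable_cong_AE:
  fixes f g :: "'a::euclidean_space \<Rightarrow> 'b"
  assumes f: "f \<in> measurable lebesgue N" and "AE x in lebesgue. f x = g x"
    and "\<And>x. g x \<in> space N"
  shows "g \<in> measurable lebesgue N"
proof (rule measurableI)
  fix A assume "A \<in> sets N"
  then have A: "f -` A \<inter> space lebesgue \<in> sets lebesgue"
    using f by (rule measurable_sets[rotated])
  have ae: "AE x in lebesgue. x \<in> f -` A \<inter> space lebesgue \<longleftrightarrow> x \<in> g -` A \<inter> space lebesgue"
    using assms(2) by eventually_elim auto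
  show "g -` A \<inter> space lebesgue \<in> sets lebesgue"
    by (rule completion.in_sets_AE[OF ae A]) simp
qed (rule assms(3))

text \<open>Tonelli's theorem is applied to \<open>lborel \<Otimes>\<^sub>M lborel\<close>, whereas
  \<open>L2 lebesgue\<close> on the plane refers to the completion of that product. Borel
  representatives carry results across.\<close>

lemma lebesgue_ex_borel_complex:
  fixes f :: "'a::euclidean_space \<Rightarrow> complex"
  assumes [measurable]: "f \<in> borel_measurable lebesgue"
  obtains f' where "f' \<in> borel_measurable borel" "AE x in lborel. f x = f' x"
proof -
  have "(\<lambda>x. Re (f x)) \<in> borel_measurable lebesgue" "(\<lambda>x. Im (f x)) \<in> borel_measurable lebesgue"
    by measurable
  then obtain r i where [measurable]: "r \<in> borel_measurable lborel" "i \<in> borel_measurable lborel"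
    and ae: "AE x in lborel. Re (f x) = r x" "AE x in lborel. Im (f x) = i x"
    by (metis completion_ex_borel_measurable_real)
  show thesis
  proof (rule that)
    show "(\<lambda>x. Complex (r x) (i x)) \<in> borel_measurable borel"
      unfolding Complex_eq by measurable
    show "AE x in lborel. f x = Complex (r x) (i x)"
      using ae by eventually_elim (simp add: complex_eq_iff)
  qed
qed

text \<open>The predicate may be nonmeasurable, so its exceptional set is enclosed in a null set
  \<open>N\<close>; the strip over \<open>N\<close> has measure 0 * \<infinity> = 0.\<close>

lemma AE_lborel_prod_fst: "AE t in lborel. P t \<Longrightarrow> AE (t, x) in (lborel :: (real \<times> real) measure). P t"
  and AE_lborel_prod_snd: "AE x in lborel. Q x \<Longrightarrow> AE (t, x) in (lborel :: (real \<times> real) measure). Q x"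
proof -
  assume "AE t in lborel. P t"
  then obtain N where N: "N \<in> null_sets lborel" "{t. \<not> P t} \<subseteq> N"
    by (auto elim: AE_E simp: null_sets_def)
  have "emeasure (lborel \<Otimes>\<^sub>M lborel) (N \<times> (UNIV :: real set)) = emeasure lborel N * emeasure lborel (UNIV :: real set)"
    using N by (intro lborel.emeasure_pair_measure_Times) auto
  then have "N \<times> (UNIV :: real set) \<in> null_sets lborel"
    using N by (auto simp: null_sets_def lborel_prod intro!: borel_Times)
  then show "AE (t, x) in (lborel :: (real \<times> real) measure). P t"
    by (rule AE_I') (use N in auto)
next
  assume "AE x in lborel. Q x"
  then obtain N where N: "N \<in> null_sets lborel" "{x. \<not> Q x} \<subseteq> N"
    by (auto elim: AE_E simp: null_sets_def)
  have "emeasure (lborel \<Otimes>\<^sub>M lborel) ((UNIV :: real set) \<times> N) = emeasure lborel (UNIV :: real set) * emeasure lborel N"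
    using N by (intro lborel.emeasure_pair_measure_Times) auto
  then have "(UNIV :: real set) \<times> N \<in> null_sets lborel"
    using N by (auto simp: null_sets_def lborel_prod intro!: borel_Times)
  then show "AE (t, x) in (lborel :: (real \<times> real) measure). Q x"
    by (rule AE_I') (use N in auto)
qed

text \<open>A Lebesgue measurable function on the plane can have nonmeasurable sections, but it
  agrees with a Borel function off a null set, almost all of whose sections are null. Hence the
  restriction to almost every \<open>t\<close> in the first claim.\<close>

lemma lebesgue_plane_sections:
  fixes w :: "real \<times> real \<Rightarrow> complex"
  assumes w: "w \<in> borel_measurable lebesgue"
  shows lebesgue_plane_measurable: "AE t in lebesgue. (\<lambda>x. w (t, x)) \<in> borel_measurable lebesgue"
    and lebesgue_plane_nn_measurable:
      "(\<lambda>t. \<integral>\<^sup>+x. ennreal ((cmod (w (t, x)))\<^sup>2) \<partial>lebesgue) \<in> borel_measurable lebesgue"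
    and lebesgue_plane_nn_integral:
      "(\<integral>\<^sup>+p. ennreal ((cmod (w p))\<^sup>2) \<partial>lebesgue) =
        (\<integral>\<^sup>+t. \<integral>\<^sup>+x. ennreal ((cmod (w (t, x)))\<^sup>2) \<partial>lebesgue \<partial>lebesgue)"
proof -
  obtain w' where [measurable]: "w' \<in> borel_measurable borel" and ae: "AE p in lborel. w p = w' p"
    using w by (rule lebesgue_ex_borel_complex)
  have [measurable]: "w' \<in> borel_measurable (lborel \<Otimes>\<^sub>M lborel)"
    by (simp add: lborel_prod)
  have "AE p in (lborel \<Otimes>\<^sub>M lborel). w p = w' p"
    unfolding lborel_prod by (rule ae)
  then have ae2: "AE t in lborel. AE x in lborel. w (t, x) = w' (t, x)"
    by (rule lborel_pair.AE_pair)
  have sec: "(\<lambda>x. w' (t, x)) \<in> borel_measurable lborel" for t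
    by measurable
  have "AE t in lborel. (\<lambda>x. w (t, x)) \<in> borel_measurable lebesgue"
    using ae2
  proof eventually_elim
    fix t assume "AE x in lborel. w (t, x) = w' (t, x)"
    then have "AE x in lebesgue. w' (t, x) = w (t, x)"
      by (intro AE_completion) auto
    then show "(\<lambda>x. w (t, x)) \<in> borel_measurable lebesgue"
      by (rule lebesgue_measurable_cong_AE[OF measurable_completion[OF sec]]) auto
  qed
  then show "AE t in lebesgue. (\<lambda>x. w (t, x)) \<in> borel_measurable lebesgue"
    by (rule AE_completion)
  have eq: "AE t in lborel. (\<integral>\<^sup>+x. ennreal ((cmod (w' (t, x)))\<^sup>2) \<partial>lborel) =
      (\<integral>\<^sup>+x. ennreal ((cmod (w (t, x)))\<^sup>2) \<partial>lebesgue)"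
    using ae2 by eventually_elim (auto simp: nn_integral_completion intro!: nn_integral_cong_AE)
  have "(\<lambda>t. \<integral>\<^sup>+x. ennreal ((cmod (w' (t, x)))\<^sup>2) \<partial>lborel) \<in> borel_measurable lborel"
    by measurable
  then show "(\<lambda>t. \<integral>\<^sup>+x. ennreal ((cmod (w (t, x)))\<^sup>2) \<partial>lebesgue) \<in> borel_measurable lebesgue"
    by (intro lebesgue_measurable_cong_AE[OF measurable_completion AE_completion[OF eq]]) auto
  have "(\<integral>\<^sup>+p. ennreal ((cmod (w p))\<^sup>2) \<partial>lebesgue) = (\<integral>\<^sup>+p. ennreal ((cmod (w' p))\<^sup>2) \<partial>lborel)"
    unfolding nn_integral_completion using ae by (intro nn_integral_cong_AE) auto
  also have "\<dots> = (\<integral>\<^sup>+p. ennreal ((cmod (w' p))\<^sup>2) \<partial>(lborel \<Otimes>\<^sub>M lborel))"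
    by (simp add: lborel_prod)
  also have "\<dots> = (\<integral>\<^sup>+t. \<integral>\<^sup>+x. ennreal ((cmod (w' (t, x)))\<^sup>2) \<partial>lborel \<partial>lborel)"
    by (rule lborel.nn_integral_fst[symmetric]) measurable
  also have "\<dots> = (\<integral>\<^sup>+t. \<integral>\<^sup>+x. ennreal ((cmod (w (t, x)))\<^sup>2) \<partial>lebesgue \<partial>lebesgue)"
    unfolding nn_integral_completion[of lborel "\<lambda>t. \<integral>\<^sup>+x. ennreal ((cmod (w (t, x)))\<^sup>2) \<partial>lebesgue"]
    by (rule nn_integral_cong_AE[OF eq])
  finally show "(\<integral>\<^sup>+p. ennreal ((cmod (w p))\<^sup>2) \<partial>lebesgue) =
        (\<integral>\<^sup>+t. \<integral>\<^sup>+x. ennreal ((cmod (w (t, x)))\<^sup>2) \<partial>lebesgue \<partial>lebesgue)" .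
qed

lemma L2_tensor:
  assumes a: "a \<in> L2 lebesgue" and g: "g \<in> L2 lebesgue"
  shows "(\<lambda>(t, x). a t * g x) \<in> L2 (lebesgue :: (real \<times> real) measure)"
proof -
  obtain a' where [measurable]: "a' \<in> borel_measurable borel" and a': "AE t in lborel. a t = a' t"
    using L2_measurable[OF a] by (rule lebesgue_ex_borel_complex)
  obtain g' where [measurable]: "g' \<in> borel_measurable borel" and g': "AE x in lborel. g x = g' x"
    using L2_measurable[OF g] by (rule lebesgue_ex_borel_complex)
  have "(\<lambda>p. a' (fst p) * g' (snd p)) \<in> borel_measurable ((lborel :: real measure) \<Otimes>\<^sub>M (lborel :: real measure))"
    by measurable
  then have "(\<lambda>p. a' (fst p) * g' (snd p)) \<in> borel_measurable (lborel :: (real \<times> real) measure)"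
    by (simp only: lborel_prod)
  then have m: "(\<lambda>(t, x). a t * g x) \<in> borel_measurable (lebesgue :: (real \<times> real) measure)"
  proof (rule lebesgue_measurable_cong_AE[OF measurable_completion AE_completion])
    show "AE p in lborel. a' (fst p) * g' (snd p) = (case p of (t, x) \<Rightarrow> a t * g x)"
      using AE_lborel_prod_fst[OF a'] AE_lborel_prod_snd[OF g'] by eventually_elim auto
  qed auto
  have [measurable]: "a \<in> borel_measurable lebesgue" "g \<in> borel_measurable lebesgue"
    using a g by (auto intro: L2_measurable)
  have "(\<integral>\<^sup>+p. ennreal ((cmod (case p of (t, x) \<Rightarrow> a t * g x))\<^sup>2) \<partial>lebesgue) =
      (\<integral>\<^sup>+t. \<integral>\<^sup>+x. ennreal ((cmod (a t))\<^sup>2) * ennreal ((cmod (g x))\<^sup>2) \<partial>lebesgue \<partial>lebesgue)"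
    by (subst lebesgue_plane_nn_integral[OF m]) (simp add: norm_mult power_mult_distrib ennreal_mult)
  also have "\<dots> = ennreal ((L2_norm lebesgue a)\<^sup>2) * ennreal ((L2_norm lebesgue g)\<^sup>2)"
    by (simp add: nn_integral_cmult nn_integral_multc flip: ennreal_L2_norm_power2[OF a] ennreal_L2_norm_power2[OF g])
  finally show ?thesis
    using m by (simp add: L2_iff_nn_integral ennreal_mult_less_top)
qed

text \<open>The substitution is the one in \<open>impulse_response\<close>. With \<open>x\<close> as
  outer variable the inner map is the reflection t \<mapsto> x - t, which preserves Lebesgue measure
  on the line.\<close>

lemma distr_lborel_shear:
  "distr lborel borel (\<lambda>(t, x). (x, x - t)) = (lborel :: (real \<times> real) measure)"
proof (rule measure_eqI)
  have [measurable]: "(\<lambda>(t, x). (x, x - t)) \<in> borel \<rightarrow>\<^sub>M (borel :: (real \<times> real) measure)"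
    unfolding case_prod_beta by (intro borel_measurable_continuous_onI continuous_intros)
  fix A assume "A \<in> sets (distr lborel borel (\<lambda>(t, x). (x, x - t :: real)))"
  then have [measurable]: "A \<in> sets (borel :: (real \<times> real) measure)" by simp
  have m1: "(\<lambda>p. indicator A p :: ennreal) \<in> borel_measurable (lborel \<Otimes>\<^sub>M lborel)"
    unfolding lborel_prod by measurable
  have m2: "(\<lambda>p. indicator A (snd p, snd p - fst p) :: ennreal) \<in> borel_measurable (lborel \<Otimes>\<^sub>M lborel)"
    by (rule measurable_compose[OF _ m1]) measurable
  have sec: "(\<lambda>u. indicator A (x, u) :: ennreal) \<in> borel_measurable borel" for x
    using measurable_compose[OF measurable_Pair1' m1, of x] by simp
  have "emeasure (distr lborel borel (\<lambda>(t, x). (x, x - t))) A =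
      (\<integral>\<^sup>+p. indicator A p \<partial>distr lborel borel (\<lambda>(t, x). (x, x - t)))"
    by simp
  also have "\<dots> = (\<integral>\<^sup>+p. indicator A (snd p, snd p - fst p) \<partial>(lborel \<Otimes>\<^sub>M lborel))"
    by (subst nn_integral_distr) (simp_all add: case_prod_beta lborel_prod)
  also have "\<dots> = (\<integral>\<^sup>+x. \<integral>\<^sup>+t. indicator A (x, x - t) \<partial>lborel \<partial>lborel)"
    using lborel_pair.nn_integral_snd[OF m2[folded case_prod_beta]] m2 by (simp add: case_prod_beta lborel_pair.nn_integral_snd[symmetric])
  also have "\<dots> = (\<integral>\<^sup>+x. \<integral>\<^sup>+u. indicator A (x, u) \<partial>lborel \<partial>lborel)"
  proof (rule nn_integral_cong)
    fix x :: real
    show "(\<integral>\<^sup>+t. indicator A (x, x - t) \<partial>lborel) = (\<integral>\<^sup>+u. indicator A (x, u) \<partial>lborel)"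
      using nn_integral_real_affine[OF sec[of x], where c = "-1" and t = x] by simp
  qed
  also have "\<dots> = (\<integral>\<^sup>+p. indicator A p \<partial>(lborel \<Otimes>\<^sub>M lborel))"
    by (rule lborel.nn_integral_fst[OF m1])
  also have "\<dots> = emeasure lborel A" by (simp add: lborel_prod)
  finally show "emeasure (distr lborel borel (\<lambda>(t, x). (x, x - t))) A = emeasure lborel A" .
qed simp

text \<open>The shear preserves measure, so null sets pull back to null sets and the choice of a
  Borel representative is harmless. This equates the norms of a kernel and its impulse
  response.\<close>

lemma nn_integral_lebesgue_shear:
  fixes \<kappa> :: "real \<times> real \<Rightarrow> complex"
  assumes "\<kappa> \<in> borel_measurable lebesgue"
  shows "(\<integral>\<^sup>+p. ennreal ((cmod (case p of (t, x) \<Rightarrow> \<kappa> (x, x - t)))\<^sup>2) \<partial>lebesgue) =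
    (\<integral>\<^sup>+p. ennreal ((cmod (\<kappa> p))\<^sup>2) \<partial>lebesgue)"
proof -
  obtain \<kappa>' where [measurable]: "\<kappa>' \<in> borel_measurable borel" and ae: "AE p in lborel. \<kappa> p = \<kappa>' p"
    using assms by (rule lebesgue_ex_borel_complex)
  have [measurable]: "(\<lambda>(t, x). (x, x - t)) \<in> borel \<rightarrow>\<^sub>M (borel :: (real \<times> real) measure)"
    unfolding case_prod_beta by (intro borel_measurable_continuous_onI continuous_intros)
  obtain N where N: "N \<in> null_sets lborel" "{p. \<kappa> p \<noteq> \<kappa>' p} \<subseteq> N"
    using ae by (auto elim: AE_E simp: null_sets_def)
  have "AE p in distr lborel borel (\<lambda>(t, x). (x, x - t)). p \<notin> N"
    unfolding distr_lborel_shear by (rule AE_not_in[OF N(1)])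
  then have "AE p in lborel. (case p of (t, x) \<Rightarrow> (x, x - t)) \<notin> N"
    using N(1) by (subst (asm) AE_distr_iff) auto
  then have "AE p in lborel. (case p of (t, x) \<Rightarrow> \<kappa> (x, x - t)) = (case p of (t, x) \<Rightarrow> \<kappa>' (x, x - t))"
    by eventually_elim (use N(2) in auto)
  then have "(\<integral>\<^sup>+p. ennreal ((cmod (case p of (t, x) \<Rightarrow> \<kappa> (x, x - t)))\<^sup>2) \<partial>lebesgue) =
      (\<integral>\<^sup>+p. ennreal ((cmod (\<kappa>' (case p of (t, x) \<Rightarrow> (x, x - t))))\<^sup>2) \<partial>lborel)"
    unfolding nn_integral_completion by (intro nn_integral_cong_AE) (auto simp: case_prod_beta)
  also have "\<dots> = (\<integral>\<^sup>+p. ennreal ((cmod (\<kappa>' p))\<^sup>2) \<partial>distr lborel borel (\<lambda>(t, x). (x, x - t)))"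
    by (subst nn_integral_distr) auto
  also have "\<dots> = (\<integral>\<^sup>+p. ennreal ((cmod (\<kappa> p))\<^sup>2) \<partial>lebesgue)"
    unfolding distr_lborel_shear nn_integral_completion using ae by (intro nn_integral_cong_AE) auto
  finally show ?thesis .
qed

lemma borel_measurable_lebesgue_translate:
  fixes f :: "real \<Rightarrow> 'b::topological_space"
  assumes "f \<in> borel_measurable lebesgue"
  shows "(\<lambda>t. f (t + c)) \<in> borel_measurable lebesgue"
proof -
  have "(\<lambda>t. c + (\<Sum>j\<in>Basis. (1 * (t \<bullet> j)) *\<^sub>R j)) \<in> lebesgue \<rightarrow>\<^sub>M (lebesgue :: real measure)"
    by (rule lebesgue_affine_measurable) simp
  then have "(\<lambda>t. t + c) \<in> lebesgue \<rightarrow>\<^sub>M (lebesgue :: real measure)"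
    by (simp add: add.commute)
  from measurable_compose[OF this assms] show ?thesis .
qed

section \<open>Elements of the tensor product\<close>

context rkhs
begin

text \<open>In each elementary tensor the second factor is replaced by its representative in
  \<open>X\<close>. This alters the finite sum only on a null set of the plane, yet puts every
  section in \<open>X\<close> and makes the restriction to each line x = t + c measurable, as a
  finite sum of products of functions of one variable.\<close>

lemma tensor_approx:
  assumes h: "h \<in> tensor_L2 (L2_Icc T) (closed_span lebesgue S)" and e: "e > 0"
  obtains q :: "real \<Rightarrow> real \<Rightarrow> complex" where
    "\<And>t. q t \<in> X" "\<And>t. t \<notin> {0..T} \<Longrightarrow> q t = (\<lambda>x. 0)"
    "\<And>c. (\<lambda>t. q t (t + c)) \<in> borel_measurable lebesgue"
    "(\<lambda>(t, x). q t x) \<in> L2 lebesgue"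
    "L2_norm lebesgue (\<lambda>(t, x). h (t, x) - q t x) < e"
proof -
  let ?P = "{(\<lambda>(t, x). a t * g x) | a g. a \<in> L2_Icc T \<and> g \<in> closed_span lebesgue S}"
  obtain p where p: "p \<in> lin_span ?P" "L2_norm lebesgue (\<lambda>z. h z - p z) < e"
    using h e unfolding tensor_L2_def closed_span_def[of lebesgue ?P] by blast
  have hm: "h \<in> borel_measurable lebesgue"
    using h by (auto simp: tensor_L2_def closed_span_def[of _ ?P] intro: L2_measurable)
  obtain F c where F: "F \<subseteq> ?P" and p_eq: "p = (\<lambda>z. \<Sum>s\<in>F. c s * s z)" and "finite F"
    using p(1) unfolding lin_span_def by blast
  \<comment> \<open>All properties of a pair of factors are bundled so that one application of
    choice selects both factors.\<close>
  define R where "R s a g \<longleftrightarrow> a \<in> L2_Icc T \<and> g \<in> X \<and>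
      (AE z in lborel. s z = (case z of (t, x) \<Rightarrow> a t * g x)) \<and> s \<in> L2 lebesgue"
    for s :: "real \<times> real \<Rightarrow> complex" and a g
  have "\<exists>p. R s (fst p) (snd p)" if s: "s \<in> F" for s
  proof -
    obtain a v where s_eq: "s = (\<lambda>(t, x). a t * v x)" and a: "a \<in> L2_Icc T" and v: "v \<in> closed_span lebesgue S"
      using subsetD[OF F s] by (elim CollectE exE conjE) blast
    obtain g where g: "g \<in> X" "AE x in lebesgue. g x = v x"
      using v by (rule X_representative)
    have "AE x in lborel. g x = v x"
      using g(2) by (simp only: AE_completion_iff)
    then have "AE z in lborel. s z = (case z of (t, x) \<Rightarrow> a t * g x)"
      unfolding s_eq by (rule eventually_mono[OF AE_lborel_prod_snd]) auto
    moreover have "s \<in> L2 lebesgue"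
      unfolding s_eq using a v by (intro L2_tensor) (auto simp: L2_Icc_def closed_span_def)
    ultimately have "R s a g" unfolding R_def using a g(1) by blast
    then show ?thesis by (intro exI[of _ "(a, g)"]) simp
  qed
  then have "\<exists>p. \<forall>s\<in>F. R s (fst (p s)) (snd (p s))" by (intro bchoice) blast
  then obtain p' where "\<And>s. s \<in> F \<Longrightarrow> R s (fst (p' s)) (snd (p' s))" by blast
  moreover define a where "a s = fst (p' s)" for s
  moreover define g where "g s = snd (p' s)" for s
  ultimately have R: "\<And>s. s \<in> F \<Longrightarrow> R s (a s) (g s)" by simp
  have ag: "\<And>s. s \<in> F \<Longrightarrow> a s \<in> L2_Icc T" "\<And>s. s \<in> F \<Longrightarrow> g s \<in> X"
    and ae: "\<And>s. s \<in> F \<Longrightarrow> AE z in lborel. s z = (case z of (t, x) \<Rightarrow> a s t * g s x)"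
    and sL2: "\<And>s. s \<in> F \<Longrightarrow> s \<in> L2 lebesgue"
    using R by (simp_all only: R_def)
  define q where "q t = (\<lambda>x. \<Sum>s\<in>F. c s * (a s t * g s x))" for t
  show thesis
  proof
    show "q t \<in> X" for t
      unfolding q_def by (intro X_sum X_scale ag)
    show "q t = (\<lambda>x. 0)" if "t \<notin> {0..T}" for t
      using ag(1) that by (auto simp: q_def L2_Icc_def)
    show "(\<lambda>t. q t (t + d)) \<in> borel_measurable lebesgue" for d
      unfolding q_def
    proof (rule borel_measurable_sum)
      fix s assume s: "s \<in> F"
      have [measurable]: "a s \<in> borel_measurable lebesgue" "(\<lambda>t. g s (t + d)) \<in> borel_measurable lebesgue"
        using ag[OF s] borel_measurable_lebesgue_translate[of "g s" d]
        by (auto simp: L2_Icc_def intro: L2_measurable X_L2)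
      show "(\<lambda>t. c s * (a s t * g s (t + d))) \<in> borel_measurable lebesgue"
        by measurable
    qed
    have "(\<lambda>(t, x). q t x) = (\<lambda>z. \<Sum>s\<in>F. c s * (case z of (t, x) \<Rightarrow> a s t * g s x))"
      by (auto simp: q_def)
    also have "\<dots> \<in> L2 lebesgue"
      using ag by (intro L2_sum L2_scale L2_tensor) (auto simp: L2_Icc_def intro: X_L2)
    finally show qL2: "(\<lambda>(t, x). q t x) \<in> L2 lebesgue" .
    have pm: "p \<in> borel_measurable lebesgue"
      unfolding p_eq using sL2 by (intro L2_measurable L2_sum L2_scale)
    have "AE z in lborel. \<forall>s\<in>F. s z = (case z of (t, x) \<Rightarrow> a s t * g s x)"
      using ae \<open>finite F\<close> by (intro AE_finite_allI) auto
    then have "AE z in lborel. p z = (case z of (t, x) \<Rightarrow> q t x)"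
      by eventually_elim (auto simp: p_eq q_def)
    then have "AE z in lebesgue. h z - p z = (case z of (t, x) \<Rightarrow> h (t, x) - q t x)"
      by (intro AE_completion) auto
    moreover have "(\<lambda>(t, x). h (t, x) - q t x) = (\<lambda>z. h z - (case z of (t, x) \<Rightarrow> q t x))"
      by auto
    ultimately have "L2_norm lebesgue (\<lambda>z. h z - p z) = L2_norm lebesgue (\<lambda>(t, x). h (t, x) - q t x)"
      using hm pm L2_measurable[OF qL2] by (intro L2_norm_cong_AE) auto
    with p(2) show "L2_norm lebesgue (\<lambda>(t, x). h (t, x) - q t x) < e" by simp
  qed
qed

text \<open>Approximation at a summable rate gives convergence of almost all sections, without passing to
  a subsequence.\<close>

lemma tensor_sections:
  assumes h: "h \<in> tensor_L2 (L2_Icc T) (closed_span lebesgue S)"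
  obtains q :: "nat \<Rightarrow> real \<Rightarrow> real \<Rightarrow> complex" where
    "\<And>m t. q m t \<in> X" "\<And>m t. t \<notin> {0..T} \<Longrightarrow> q m t = (\<lambda>x. 0)"
    "\<And>m c. (\<lambda>t. q m t (t + c)) \<in> borel_measurable lebesgue"
    "AE t in lebesgue. (\<lambda>x. h (t, x)) \<in> L2 lebesgue \<and> (\<lambda>m. nrm (\<lambda>x. h (t, x) - q m t x)) \<longlonglongrightarrow> 0"
proof -
  define Q where "Q m q \<longleftrightarrow> (\<forall>t. q t \<in> X) \<and> (\<forall>t. t \<notin> {0..T} \<longrightarrow> q t = (\<lambda>x. 0)) \<and>
    (\<forall>c. (\<lambda>t. q t (t + c)) \<in> borel_measurable lebesgue) \<and> (\<lambda>(t, x). q t x) \<in> L2 lebesgue \<and>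
    L2_norm lebesgue (\<lambda>(t, x). h (t, x) - q t x) < (1 / 2) ^ m"
    for m :: nat and q :: "real \<Rightarrow> real \<Rightarrow> complex"
  have "\<exists>q. Q m q" for m
    unfolding Q_def by (rule tensor_approx[OF h, of "(1 / 2) ^ m"]) auto
  then obtain q where Q: "Q m (q m)" for m by metis
  have q: "q m t \<in> X" "t \<notin> {0..T} \<Longrightarrow> q m t = (\<lambda>x. 0)"
    "(\<lambda>t. q m t (t + c)) \<in> borel_measurable lebesgue"
    "(\<lambda>(t, x). q m t x) \<in> L2 lebesgue"
    "L2_norm lebesgue (\<lambda>(t, x). h (t, x) - q m t x) < (1 / 2) ^ m" for m t c
    using Q[of m] unfolding Q_def by blast+
  have hL2: "h \<in> L2 lebesgue"
    using h by (simp add: tensor_L2_def closed_span_def)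
  define w where "w m = (\<lambda>(t, x). h (t, x) - q m t x)" for m
  have "w m = (\<lambda>z. h z - (case z of (t, x) \<Rightarrow> q m t x))" for m
    by (auto simp: w_def)
  then have wL2: "w m \<in> L2 lebesgue" for m
    using L2_diff[OF hL2 q(4)] by simp
  define E where "E m t = (\<integral>\<^sup>+x. ennreal ((cmod (w m (t, x)))\<^sup>2) \<partial>lebesgue)" for m t
  have Em [measurable]: "E m \<in> borel_measurable lebesgue" for m
    unfolding E_def by (rule lebesgue_plane_nn_measurable[OF L2_measurable[OF wL2]])
  have "(\<integral>\<^sup>+t. E m t \<partial>lebesgue) \<le> ennreal ((1 / 4) ^ m)" for m
  proof -
    have "(\<integral>\<^sup>+t. E m t \<partial>lebesgue) = ennreal ((L2_norm lebesgue (w m))\<^sup>2)"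
      unfolding E_def
      by (simp only: ennreal_L2_norm_power2[OF wL2] lebesgue_plane_nn_integral[OF L2_measurable[OF wL2]])
    also have "(L2_norm lebesgue (w m))\<^sup>2 \<le> ((1 / 2) ^ m)\<^sup>2"
      using q(5)[of m] by (intro power_mono) (auto simp: w_def)
    also have "((1 / 2) ^ m)\<^sup>2 = ((1 / 4) ^ m :: real)"
      by (simp add: power2_eq_square flip: power_mult_distrib)
    finally show ?thesis by (simp add: ennreal_leI)
  qed
  \<comment> \<open>The squared errors are summable, so the sum of the sectional errors has finite
    integral and is finite for almost every \<open>t\<close>; its terms then tend to 0.\<close>
  then have "(\<integral>\<^sup>+t. (\<Sum>m. E m t) \<partial>lebesgue) \<le> (\<Sum>m. ennreal ((1 / 4) ^ m))"
    by (subst nn_integral_suminf) (auto intro: Em suminf_le)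
  also have "\<dots> < \<infinity>"
    by (subst suminf_ennreal2) (auto intro: summable_geometric)
  finally have fin: "AE t in lebesgue. (\<Sum>m. E m t) \<noteq> \<infinity>"
    by (intro nn_integral_PInf_AE) auto
  have "AE t in lebesgue. \<forall>m. (\<lambda>x. w m (t, x)) \<in> borel_measurable lebesgue"
    unfolding AE_all_countable by (intro allI lebesgue_plane_measurable L2_measurable wL2)
  with fin have "AE t in lebesgue. (\<lambda>x. h (t, x)) \<in> L2 lebesgue \<and>
      (\<lambda>m. nrm (\<lambda>x. h (t, x) - q m t x)) \<longlonglongrightarrow> 0"
  proof eventually_elim
    case (elim t)
    have "E m t < \<infinity>" for m
    proof -
      have "E m t \<le> (\<Sum>m. E m t)"
        using sum_le_suminf[of "\<lambda>m. E m t" "{m}"] by simp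
      then show ?thesis using elim(1) by (simp add: less_top top.not_eq_extremum le_less_trans)
    qed
    then have wt: "(\<lambda>x. w m (t, x)) \<in> L2 lebesgue" for m
      using elim(2) by (simp add: L2_iff_nn_integral E_def)
    \<comment> \<open>The section of \<open>h\<close> is recovered from the error at index 0 by
      adding back \<open>q 0 t\<close>.\<close>
    have "(\<lambda>x. w 0 (t, x) + q 0 t x) \<in> L2 lebesgue"
      by (intro L2_add wt X_L2 q(1))
    then have "(\<lambda>x. h (t, x)) \<in> L2 lebesgue" by (simp add: w_def)
    moreover have "summable (\<lambda>m. (nrm (\<lambda>x. w m (t, x)))\<^sup>2)"
      using elim(1) by (intro summable_suminf_not_top) (auto simp: ennreal_L2_norm_power2[OF wt] E_def)
    then have "(\<lambda>m. sqrt ((nrm (\<lambda>x. w m (t, x)))\<^sup>2)) \<longlonglongrightarrow> sqrt 0"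
      by (intro tendsto_real_sqrt summable_LIMSEQ_zero)
    then have "(\<lambda>m. nrm (\<lambda>x. w m (t, x))) \<longlonglongrightarrow> 0"
      unfolding real_sqrt_zero real_sqrt_abs abs_of_nonneg[OF L2_norm_nonneg] .
    ultimately show ?case by (simp add: w_def)
  qed
  with q(1-3) show thesis by (rule that)
qed

end

section \<open>The response to the delta train\<close>

lemma AE_lebesgue_translate:
  assumes "AE t in lebesgue. P t"
  shows "AE t in lebesgue. P (t + c :: real)"
proof -
  obtain N where N: "N \<in> null_sets lborel" "{t. \<not> P t} \<subseteq> N"
    using assms unfolding AE_completion_iff by (auto elim: AE_E simp: null_sets_def)
  have "AE t in lborel. c + 1 * t \<notin> N"
    by (rule AE_borel_affine) (use N(1) AE_not_in[OF N(1)] in auto)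
  then have "AE t in lborel. P (t + c)"
    by eventually_elim (use N(2) in \<open>auto simp: add.commute\<close>)
  then show ?thesis by (rule AE_completion)
qed

text \<open>The half-open interval makes the translates a partition of the line; the closed one
  would count multiples of \<open>T\<close> twice.\<close>

lemma floor_translate_unique:
  fixes T x :: real
  assumes "T > 0"
  shows "x - of_int n * T \<in> {0..<T} \<longleftrightarrow> n = \<lfloor>x / T\<rfloor>"
  using assms by (auto simp: floor_eq_iff eq_commute[of n] field_simps)

text \<open>The indicators of the translates of [0,T) sum to 1. They are inserted, sum and integral
  are exchanged, and each term is translated back.\<close>

lemma nn_integral_periodize:
  fixes f :: "real \<Rightarrow> ennreal"
  assumes f [measurable]: "f \<in> borel_measurable lebesgue" and T: "T > 0"
  shows "(\<integral>\<^sup>+x. f x \<partial>lebesgue) =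
    (\<integral>\<^sup>+t. (\<integral>\<^sup>+n. f (t + of_int n * T) \<partial>count_space (UNIV :: int set)) * indicator {0..<T} t \<partial>lebesgue)"
proof -
  let ?I = "\<lambda>n t. indicator {0..<T} (t - of_int n * T) :: ennreal"
  have [measurable]: "(\<lambda>t. indicator {0..<T} (t + c) :: ennreal) \<in> borel_measurable lebesgue" for c
    by (rule borel_measurable_lebesgue_translate) (auto intro: measurable_completion)
  have [measurable]: "(indicator {0..<T} :: real \<Rightarrow> ennreal) \<in> borel_measurable lebesgue"
    by (rule borel_measurable_indicator) simp
  have [measurable]: "?I n \<in> borel_measurable lebesgue" for n :: int
    by (subst diff_conv_add_uminus) measurable
  have [measurable]: "(\<lambda>t. f (t + c)) \<in> borel_measurable lebesgue" for c
    by (rule borel_measurable_lebesgue_translate[OF f])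
  have "(\<integral>\<^sup>+n. f x * ?I n x \<partial>count_space UNIV) = f x" for x
  proof -
    have "(\<integral>\<^sup>+n. f x * ?I n x \<partial>count_space UNIV) = (\<Sum>n\<in>{\<lfloor>x / T\<rfloor>}. f x * ?I n x)"
      by (rule nn_integral_count_space') (use floor_translate_unique[OF T, of x] in \<open>auto simp: indicator_def\<close>)
    also have "\<dots> = f x"
      using floor_translate_unique[OF T, of x "\<lfloor>x / T\<rfloor>"] by (simp add: indicator_def)
    finally show ?thesis .
  qed
  then have "(\<integral>\<^sup>+x. f x \<partial>lebesgue) = (\<integral>\<^sup>+x. \<integral>\<^sup>+n. f x * ?I n x \<partial>count_space UNIV \<partial>lebesgue)"
    by simp
  also have "\<dots> = (\<integral>\<^sup>+n. \<integral>\<^sup>+x. f x * ?I n x \<partial>lebesgue \<partial>count_space UNIV)"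
    by (rule nn_integral_count_space_nn_integral) auto
  also have "\<dots> = (\<integral>\<^sup>+n. \<integral>\<^sup>+t. f (t + of_int n * T) * indicator {0..<T} t \<partial>lebesgue \<partial>count_space UNIV)"
  proof (rule nn_integral_cong)
    fix n :: int
    have "(\<lambda>x. f x * ?I n x) \<in> borel_measurable lebesgue" by measurable
    from nn_integral_real_affine_lebesgue[OF this, where c = 1 and t = "of_int n * T"]
    show "(\<integral>\<^sup>+x. f x * ?I n x \<partial>lebesgue) = (\<integral>\<^sup>+t. f (t + of_int n * T) * indicator {0..<T} t \<partial>lebesgue)"
      by (simp add: add.commute)
  qed
  also have "\<dots> = (\<integral>\<^sup>+t. \<integral>\<^sup>+n. f (t + of_int n * T) * indicator {0..<T} t \<partial>count_space UNIV \<partial>lebesgue)"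
    by (rule nn_integral_count_space_nn_integral[symmetric]) (simp, measurable)
  also have "\<dots> = (\<integral>\<^sup>+t. (\<integral>\<^sup>+n. f (t + of_int n * T) \<partial>count_space UNIV) * indicator {0..<T} t \<partial>lebesgue)"
    by (simp add: nn_integral_multc)
  finally show ?thesis .
qed

lemma nn_integral_count_space_infsum:
  fixes c :: "'i \<Rightarrow> real"
  assumes "c summable_on UNIV" "\<And>i. 0 \<le> c i"
  shows "(\<integral>\<^sup>+i. ennreal (c i) \<partial>count_space UNIV) = ennreal (\<Sum>\<^sub>\<infinity>i. c i)"
proof -
  have "Infinite_Set_Sum.abs_summable_on c UNIV"
    using assms by (simp flip: abs_summable_equivalent)
  then show ?thesis
    using assms(2) by (simp add: nn_integral_conv_infsetsum infsetsum_infsum)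
qed

section \<open>Impulse response and delta train response of one operator\<close>

locale rkhs_operator = rkhs +
  fixes T :: real and H :: "(real \<Rightarrow> complex) \<Rightarrow> real \<Rightarrow> complex"
  assumes T_pos: "T > 0" and HS: "H \<in> HS"
    and tensor: "(\<lambda>(t, x). impulse_response H t x) \<in> tensor_L2 (L2_Icc T) (closed_span lebesgue S)"
begin

abbreviation h :: "real \<Rightarrow> real \<Rightarrow> complex" where "h \<equiv> impulse_response H"

abbreviation G :: "real \<Rightarrow> real \<Rightarrow> complex" where "G \<equiv> impulse_response_in X H"

abbreviation \<delta> :: "real \<Rightarrow> complex" where "\<delta> \<equiv> delta_train_response X T H"

lemma h_measurable: "(\<lambda>(t, x). h t x) \<in> borel_measurable lebesgue"
  using tensor by (auto simp: tensor_L2_def closed_span_def intro: L2_measurable)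

lemma hs_norm_eq:
  "ennreal ((hs_norm H)\<^sup>2) = (\<integral>\<^sup>+t. \<integral>\<^sup>+x. ennreal ((cmod (h t x))\<^sup>2) \<partial>lebesgue \<partial>lebesgue)"
proof -
  obtain \<kappa> where "is_hs_kernel H \<kappa>"
    using HS by (auto simp: HS_def)
  then have "is_hs_kernel H (hs_kernel H)"
    unfolding hs_kernel_def by (rule someI[of "is_hs_kernel H"])
  then have \<kappa>: "hs_kernel H \<in> L2 lebesgue"
    by (simp add: is_hs_kernel_def)
  have "ennreal ((hs_norm H)\<^sup>2) = (\<integral>\<^sup>+p. ennreal ((cmod (case p of (t, x) \<Rightarrow> h t x))\<^sup>2) \<partial>lebesgue)"
    unfolding hs_norm_def impulse_response_def nn_integral_lebesgue_shear[OF L2_measurable[OF \<kappa>]]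
    by (rule ennreal_L2_norm_power2[OF \<kappa>])
  then show ?thesis
    by (simp add: lebesgue_plane_nn_integral[OF h_measurable])
qed

text \<open>The approximants stay in the statement because measurability of \<delta> is derived from
  them along the lines x = t + c. Convergence of sections in the norm of \<open>X\<close> allows the
  quantifier over all \<open>y\<close> to stand inside the almost-everywhere condition.\<close>

lemma impulse_response_in_approx:
  "\<exists>q :: nat \<Rightarrow> real \<Rightarrow> real \<Rightarrow> complex.
    (\<forall>m c. (\<lambda>t. q m t (t + c)) \<in> borel_measurable lebesgue) \<and>
    (AE t in lebesgue. G t \<in> X \<and> (AE x in lebesgue. G t x = h t x) \<and>
      (t \<notin> {0..T} \<longrightarrow> G t = (\<lambda>x. 0)) \<and> (\<forall>y. (\<lambda>m. q m t y) \<longlonglongrightarrow> G t y))"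
proof -
  obtain q :: "nat \<Rightarrow> real \<Rightarrow> real \<Rightarrow> complex" where
    q: "\<And>m t. q m t \<in> X" "\<And>m t. t \<notin> {0..T} \<Longrightarrow> q m t = (\<lambda>x. 0)"
      "\<And>m c. (\<lambda>t. q m t (t + c)) \<in> borel_measurable lebesgue"
    and ae: "AE t in lebesgue. (\<lambda>x. h t x) \<in> L2 lebesgue \<and> (\<lambda>m. nrm (\<lambda>x. h t x - q m t x)) \<longlonglongrightarrow> 0"
    using tensor_sections[OF tensor] by (simp only: prod.case) blast
  have "AE t in lebesgue. G t \<in> X \<and> (AE x in lebesgue. G t x = h t x) \<and>
      (t \<notin> {0..T} \<longrightarrow> G t = (\<lambda>x. 0)) \<and> (\<forall>y. (\<lambda>m. q m t y) \<longlonglongrightarrow> G t y)"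
    using ae
  proof eventually_elim
    case (elim t)
    then have hL2: "h t \<in> L2 lebesgue" and lim: "(\<lambda>m. nrm (\<lambda>x. h t x - q m t x)) \<longlonglongrightarrow> 0"
      by auto
    have "h t \<in> closed_span lebesgue S"
    proof (rule closed_span_closed[OF hL2])
      fix e :: real assume "e > 0"
      then have "eventually (\<lambda>m. nrm (\<lambda>x. h t x - q m t x) < e) sequentially"
        by (rule order_tendstoD(2)[OF lim])
      then obtain m where "nrm (\<lambda>x. h t x - q m t x) < e"
        by (auto simp: eventually_sequentially)
      then show "\<exists>v\<in>closed_span lebesgue S. nrm (\<lambda>x. h t x - v x) < e"
        using X_subset[OF q(1)] by blast
    qed
    then obtain g where g: "g \<in> X" "AE x in lebesgue. g x = h t x"
      by (rule X_representative)
    have Gg: "G t = g"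
      unfolding impulse_response_in_def
    proof (rule the_equality)
      fix g' assume g': "g' \<in> X \<and> (AE x in lebesgue. g' x = h t x)"
      then have "AE x in lebesgue. g' x = h t x" by blast
      with g(2) have "AE x in lebesgue. g' x = g x" by eventually_elim simp
      with g' g(1) show "g' = g" by (intro X_eq_of_AE) auto
    qed (use g in blast)
    have dist: "nrm (\<lambda>x. q m t x - g x) = nrm (\<lambda>x. h t x - q m t x)" for m
      unfolding L2_norm_minus_commute[of _ "h t"]
      using g(2) L2_measurable[OF X_L2[OF q(1)[of m t]]] L2_measurable[OF X_L2[OF g(1)]] L2_measurable[OF hL2]
      by (intro L2_norm_cong_AE borel_measurable_diff) auto
    have "g = (\<lambda>x. 0)" if "t \<notin> {0..T}"
    proof (rule X_eq_of_nrm[OF g(1) X_zero])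
      have "(\<lambda>m::nat. nrm (\<lambda>x. 0 - g x)) \<longlonglongrightarrow> 0"
        using lim[folded dist] unfolding q(2)[OF that] .
      then have "nrm (\<lambda>x. 0 - g x) = 0"
        by (rule LIMSEQ_unique[OF tendsto_const])
      then show "nrm (\<lambda>x. g x - 0) = 0"
        by (subst L2_norm_minus_commute)
    qed
    moreover have "(\<lambda>m. q m t y) \<longlonglongrightarrow> g y" for y
    proof (rule LIM_zero_cancel, rule Lim_null_comparison)
      show "eventually (\<lambda>m. norm (q m t y - g y) \<le> nrm (\<lambda>x. q m t x - g x) * nrm (\<lambda>s. k s y)) sequentially"
        using cmod_le_nrm[OF X_diff[OF q(1) g(1)]] by simp
      show "(\<lambda>m. nrm (\<lambda>x. q m t x - g x) * nrm (\<lambda>s. k s y)) \<longlonglongrightarrow> 0"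
        unfolding dist using lim by (rule tendsto_mult_left_zero)
    qed
    ultimately show ?case using g by (simp add: Gg)
  qed
  with q(3) show ?thesis by blast
qed

lemma impulse_response_in_AE:
  "AE t in lebesgue. G t \<in> X \<and> (AE x in lebesgue. G t x = h t x) \<and> (t \<notin> {0..T} \<longrightarrow> G t = (\<lambda>x. 0))"
proof -
  obtain q :: "nat \<Rightarrow> real \<Rightarrow> real \<Rightarrow> complex" where
    "AE t in lebesgue. G t \<in> X \<and> (AE x in lebesgue. G t x = h t x) \<and>
      (t \<notin> {0..T} \<longrightarrow> G t = (\<lambda>x. 0)) \<and> (\<forall>y. (\<lambda>m. q m t y) \<longlonglongrightarrow> G t y)"
    using impulse_response_in_approx by blast
  then show ?thesis by (rule eventually_mono) blast
qed

lemma nrm_impulse_response_in: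
  "AE t in lebesgue. ennreal ((nrm (G t))\<^sup>2) = (\<integral>\<^sup>+x. ennreal ((cmod (h t x))\<^sup>2) \<partial>lebesgue)"
  using impulse_response_in_AE
proof eventually_elim
  case (elim t)
  then show ?case
    by (subst ennreal_L2_norm_power2) (auto intro!: X_L2 nn_integral_cong_AE)
qed

text \<open>For almost every \<open>t \<in> [0,T]\<close> all translates \<open>t + n T\<close> are points where the response is
  defined, and only one term of the defining series of \<open>\<delta>\<close> survives.\<close>

lemma \<delta>_eq: "AE t in lebesgue. t \<in> {0..T} \<longrightarrow> (\<forall>n::int. \<delta> (t + of_int n * T) = G t (t + of_int n * T))"
proof -
  have "AE t in lebesgue. \<forall>m::int. t + of_int m * T \<notin> {0..T} \<longrightarrow> G (t + of_int m * T) = (\<lambda>x. 0)"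
    unfolding AE_all_countable
    by (intro allI AE_lebesgue_translate eventually_mono[OF impulse_response_in_AE]) blast
  \<comment> \<open>At t = 0 and t = T a second translate of \<open>t\<close> would fall into the
    closed interval, and a second term could survive.\<close>
  moreover have "AE t in lebesgue. t \<noteq> (0::real)" "AE t in lebesgue. t \<noteq> T"
    by (auto intro: AE_completion AE_lborel_singleton)
  ultimately show ?thesis
  proof eventually_elim
    case (elim t)
    show ?case
    proof (intro impI allI)
      fix n :: int
      assume "t \<in> {0..T}"
      then have t: "0 < t" "t < T" using elim by auto
      have "G (t + of_int n * T - of_int j * T) (t + of_int n * T) = 0" if "j \<noteq> n" for j
      proof -
        have "t + of_int (n - j) * T \<notin> {0..T}"
        proof (cases "n - j \<ge> 1")
          case True
          then have "1 * T \<le> of_int (n - j) * T" using T_pos by (intro mult_right_mono) linarith+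
          then show ?thesis unfolding atLeastAtMost_iff using t by linarith
        next
          case False
          then have "of_int (n - j) * T \<le> - 1 * T" using T_pos that by (intro mult_right_mono) linarith+
          then show ?thesis unfolding atLeastAtMost_iff using t by linarith
        qed
        then have "G (t + of_int (n - j) * T) = (\<lambda>x. 0)" using elim(1) by blast
        then show ?thesis by (simp add: algebra_simps)
      qed
      then show "\<delta> (t + of_int n * T) = G t (t + of_int n * T)"
        unfolding delta_train_response_def
        by (intro infsumI has_sum_finite_neutralI[of "{n}"]) auto
    qed
  qed
qed

text \<open>On the tile with index n = floor (x / T) the value at x is almost everywhere
  \<open>G t (t + of_int n * T)\<close> with t = x - n T, a limit of measurable functions of t. The
  countably many tiles are then glued.\<close>

lemma \<delta>_measurable: "\<delta> \<in> borel_measurable lebesgue"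
proof -
  obtain q :: "nat \<Rightarrow> real \<Rightarrow> real \<Rightarrow> complex" where
    q [measurable]: "\<And>m c. (\<lambda>t. q m t (t + c)) \<in> borel_measurable lebesgue"
    and ae: "AE t in lebesgue. G t \<in> X \<and> (AE x in lebesgue. G t x = h t x) \<and>
      (t \<notin> {0..T} \<longrightarrow> G t = (\<lambda>x. 0)) \<and> (\<forall>y. (\<lambda>m. q m t y) \<longlonglongrightarrow> G t y)"
    using impulse_response_in_approx by blast
  \<comment> \<open>\<open>lim\<close> is total, so \<open>F n\<close> is measurable everywhere; it
    has the intended value for almost every \<open>t\<close> in [0,T].\<close>
  define F where "F n t = lim (\<lambda>m. q m t (t + of_int n * T))" for n :: int and t
  have "F n \<in> borel_measurable lebesgue" for n
    unfolding F_def by measurable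
  then have "(\<lambda>x. F n (x + - (of_int n * T))) \<in> borel_measurable lebesgue" for n
    by (rule borel_measurable_lebesgue_translate)
  moreover have "(\<lambda>x. \<lfloor>x / T\<rfloor>) \<in> lebesgue \<rightarrow>\<^sub>M count_space UNIV"
    by (rule measurable_completion) measurable
  ultimately have "(\<lambda>x. F \<lfloor>x / T\<rfloor> (x + - (of_int \<lfloor>x / T\<rfloor> * T))) \<in> borel_measurable lebesgue"
    by (rule measurable_compose_countable)
  then show ?thesis
  proof (rule lebesgue_measurable_cong_AE)
    have "AE t in lebesgue. t \<in> {0..T} \<longrightarrow> (\<forall>n::int. \<delta> (t + of_int n * T) = F n t)"
      using \<delta>_eq ae by eventually_elim (auto simp: F_def intro!: limI[symmetric])
    \<comment> \<open>One null set serves all shifts by multiples of \<open>T\<close>, so the shift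
      may depend on \<open>x\<close> through the floor.\<close>
    then have "AE x in lebesgue. \<forall>m::int. x + of_int m * T \<in> {0..T} \<longrightarrow>
        (\<forall>n::int. \<delta> (x + of_int m * T + of_int n * T) = F n (x + of_int m * T))"
      unfolding AE_all_countable by (intro allI AE_lebesgue_translate)
    then show "AE x in lebesgue. F \<lfloor>x / T\<rfloor> (x + - (of_int \<lfloor>x / T\<rfloor> * T)) = \<delta> x"
    proof eventually_elim
      case (elim x)
      have "x - of_int \<lfloor>x / T\<rfloor> * T \<in> {0..<T}"
        using floor_translate_unique[OF T_pos] by blast
      then have "\<delta> (x + of_int (- \<lfloor>x / T\<rfloor>) * T + of_int \<lfloor>x / T\<rfloor> * T) = F \<lfloor>x / T\<rfloor> (x + of_int (- \<lfloor>x / T\<rfloor>) * T)"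
        by (intro elim[rule_format]) auto
      then show ?case by simp
    qed
  qed simp
qed

text \<open>Periodizing the squared modulus of \<delta> gives at \<open>t\<close> the sum of the
  squared samples of \<open>G t\<close>, which by the reproducing property is its frame sum. As
  \<open>A\<close> and \<open>B\<close> do not depend on \<open>t\<close>, the frame inequalities
  can be integrated.\<close>

lemma \<delta>_bounds:
  assumes frames: "\<And>t. t \<in> {0..T} \<Longrightarrow> frame_bounds X (\<lambda>(n::int) s. k s (t + of_int n * T)) A B"
  shows "\<delta> \<in> L2 lebesgue" "sqrt A * hs_norm H \<le> nrm \<delta>" "nrm \<delta> \<le> sqrt B * hs_norm H"
proof -
  have AB: "A > 0" "B > 0"
    using frames[of 0] T_pos by (auto simp: frame_bounds_def)
  define D where "D t = (\<integral>\<^sup>+n. ennreal ((cmod (\<delta> (t + of_int n * T)))\<^sup>2) \<partial>count_space (UNIV :: int set)) *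
      indicator {0..<T} t" for t
  define E where "E t = (\<integral>\<^sup>+x. ennreal ((cmod (h t x))\<^sup>2) \<partial>lebesgue)" for t
  have E_meas: "E \<in> borel_measurable lebesgue"
    using lebesgue_plane_nn_measurable[OF h_measurable] by (simp add: E_def[abs_def])
  have E_int: "(\<integral>\<^sup>+t. E t \<partial>lebesgue) = ennreal ((hs_norm H)\<^sup>2)"
    by (simp add: E_def hs_norm_eq)
  have D_int: "(\<integral>\<^sup>+x. ennreal ((cmod (\<delta> x))\<^sup>2) \<partial>lebesgue) = (\<integral>\<^sup>+t. D t \<partial>lebesgue)"
    unfolding D_def using \<delta>_measurable by (intro nn_integral_periodize T_pos) measurable
  \<comment> \<open>The frames are indexed by the closed interval, \<open>D\<close> is supported on
    the half-open one; the point \<open>T\<close> is discarded as a null set.\<close>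
  have T_ae: "AE t in lebesgue. t \<noteq> T"
    by (intro AE_completion AE_lborel_singleton)
  have DE: "AE t in lebesgue. ennreal A * E t \<le> D t \<and> D t \<le> ennreal B * E t"
    using impulse_response_in_AE nrm_impulse_response_in \<delta>_eq T_ae
  proof eventually_elim
    case (elim t)
    then have GX: "G t \<in> X" and E: "E t = ennreal ((nrm (G t))\<^sup>2)"
      by (auto simp: E_def)
    show ?case
    proof (cases "t \<in> {0..T}")
      case True
      let ?c = "\<lambda>n::int. (cmod (ip (G t) (\<lambda>s. k s (t + of_int n * T))))\<^sup>2"
      have c: "?c summable_on UNIV" "A * (nrm (G t))\<^sup>2 \<le> infsum ?c UNIV" "infsum ?c UNIV \<le> B * (nrm (G t))\<^sup>2"
        using frames[OF True] GX by (auto simp: frame_bounds_def)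
      have "D t = (\<integral>\<^sup>+n. ennreal (?c n) \<partial>count_space UNIV)"
        using True elim by (simp add: D_def flip: reproducing[OF GX])
      also have "\<dots> = ennreal (infsum ?c UNIV)"
        by (rule nn_integral_count_space_infsum[OF c(1)]) simp
      finally show ?thesis
        using c(2,3) AB by (simp add: E ennreal_leI flip: ennreal_mult)
    next
      case False
      then have "E t = 0" "D t = 0"
        using elim by (auto simp: E D_def L2_norm_def)
      then show ?thesis by simp
    qed
  qed
  have upper: "(\<integral>\<^sup>+x. ennreal ((cmod (\<delta> x))\<^sup>2) \<partial>lebesgue) \<le> ennreal (B * (hs_norm H)\<^sup>2)"
  proof -
    have "(\<integral>\<^sup>+t. D t \<partial>lebesgue) \<le> (\<integral>\<^sup>+t. ennreal B * E t \<partial>lebesgue)"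
      using DE by (intro nn_integral_mono_AE) auto
    then show ?thesis
      using AB by (simp add: D_int nn_integral_cmult[OF E_meas] E_int ennreal_mult)
  qed
  then show \<delta>_L2: "\<delta> \<in> L2 lebesgue"
    using \<delta>_measurable by (simp add: L2_iff_nn_integral le_less_trans)
  have lower: "ennreal (A * (hs_norm H)\<^sup>2) \<le> (\<integral>\<^sup>+x. ennreal ((cmod (\<delta> x))\<^sup>2) \<partial>lebesgue)"
  proof -
    have "(\<integral>\<^sup>+t. ennreal A * E t \<partial>lebesgue) \<le> (\<integral>\<^sup>+t. D t \<partial>lebesgue)"
      using DE by (intro nn_integral_mono_AE) auto
    then show ?thesis
      using AB by (simp add: D_int nn_integral_cmult[OF E_meas] E_int ennreal_mult)
  qed
  have hs: "0 \<le> hs_norm H" by (simp add: hs_norm_def)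
  have "A * (hs_norm H)\<^sup>2 \<le> (nrm \<delta>)\<^sup>2" "(nrm \<delta>)\<^sup>2 \<le> B * (hs_norm H)\<^sup>2"
    using lower upper AB by (simp_all flip: ennreal_L2_norm_power2[OF \<delta>_L2])
  then have "sqrt (A * (hs_norm H)\<^sup>2) \<le> sqrt ((nrm \<delta>)\<^sup>2)" "sqrt ((nrm \<delta>)\<^sup>2) \<le> sqrt (B * (hs_norm H)\<^sup>2)"
    by (simp_all only: real_sqrt_le_iff)
  then show "sqrt A * hs_norm H \<le> nrm \<delta>" "nrm \<delta> \<le> sqrt B * hs_norm H"
    using hs by (simp_all add: real_sqrt_mult)
qed

text \<open>The coefficients of \<open>G t\<close> against the kernel sections are its samples,
  hence values of \<delta>, so its dual expansion is the claimed series. Off [0,T] the indicator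
  removes every term, whatever \<open>kd\<close> is there, and \<open>G t\<close> vanishes.\<close>

lemma reconstruction:
  fixes kd :: "int \<Rightarrow> real \<Rightarrow> real \<Rightarrow> complex"
  assumes "AE t in lebesgue. t \<in> {0..T} \<longrightarrow>
      dual_frame X (\<lambda>n s. k s (t + of_int n * T)) (\<lambda>n x. kd n x t)"
  shows "AE t in lebesgue. G t \<in> X \<and> (AE x in lebesgue. G t x = h t x) \<and>
      L2_has_sum lebesgue (\<lambda>n x. indicator {0..T} t * \<delta> (t + of_int n * T) * kd n x t) (G t) \<and>
      (\<forall>x. ((\<lambda>n. indicator {0..T} t * \<delta> (t + of_int n * T) * kd n x t) has_sum G t x) UNIV)"
  using assms impulse_response_in_AE \<delta>_eq
proof eventually_elim
  case (elim t)
  then have GX: "G t \<in> X" by blast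
  show ?case
  proof (cases "t \<in> {0..T}")
    case True
    let ?f = "\<lambda>n x. indicator {0..T} t * \<delta> (t + of_int n * T) * kd n x t"
    have dual: "dual_frame X (\<lambda>n s. k s (t + of_int n * T)) (\<lambda>n x. kd n x t)"
      using elim(1) True by blast
    then have "(\<lambda>x. kd n x t) \<in> X" for n
      unfolding dual_frame_def is_frame_def frame_bounds_def by blast
    then have fX: "(\<lambda>x. ?f n x) \<in> X" for n
      by (rule X_scale)
    have coeff: "ip (G t) (\<lambda>s. k s (t + of_int n * T)) = indicator {0..T} t * \<delta> (t + of_int n * T)" for n
      using True elim(3) by (simp flip: reproducing[OF GX])
    have "L2_has_sum lebesgue (\<lambda>n x. ip (G t) (\<lambda>s. k s (t + of_int n * T)) * kd n x t) (G t)"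
      using dual GX unfolding dual_frame_def by blast
    then have "L2_has_sum lebesgue ?f (G t)"
      by (simp only: coeff)
    with pointwise_has_sum[OF fX GX this] elim(2) show ?thesis by blast
  next
    case False
    then have "G t = (\<lambda>x. 0)" using elim(2) by blast
    with elim(2) False show ?thesis
      by (simp add: L2_has_sum_def L2_norm_def)
  qed
qed

end

text \<open>The existence of dual families is asserted separately, so that the reconstruction,
  stated for every such family, has content.\<close>

theorem theorem3p3:
  fixes T :: real and \<phi> :: "real \<Rightarrow> complex"
    and X :: "(real \<Rightarrow> complex) set" and k :: "real \<Rightarrow> real \<Rightarrow> complex"
  assumes "T > 0"
    and "\<phi> \<in> L2 lebesgue"
    and "riesz_sequence (\<lambda>(n::int) x. \<phi> (x - of_int n * T))"
    and "function_space_of (V_space T \<phi>) X"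
    and "reproducing_kernel X k"
    and "\<And>t. t \<in> {0..T} \<Longrightarrow> is_frame X (\<lambda>(n::int) s. k s (t + of_int n * T))"
  shows "(uniform_frames X {0..T} (\<lambda>t (n::int) s. k s (t + of_int n * T)) \<longrightarrow>
           (\<exists>c>0. \<exists>C>0. \<forall>H \<in> op_class T \<phi>.
              delta_train_response X T H \<in> L2 lebesgue \<and>
              c * hs_norm H \<le> L2_norm lebesgue (delta_train_response X T H) \<and>
              L2_norm lebesgue (delta_train_response X T H) \<le> C * hs_norm H)) \<and>
         (\<exists>kd :: int \<Rightarrow> real \<Rightarrow> real \<Rightarrow> complex. AE t in lebesgue. t \<in> {0..T} \<longrightarrow>
            dual_frame X (\<lambda>n s. k s (t + of_int n * T)) (\<lambda>n x. kd n x t)) \<and>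
         (\<forall>kd :: int \<Rightarrow> real \<Rightarrow> real \<Rightarrow> complex.
            (AE t in lebesgue. t \<in> {0..T} \<longrightarrow>
               dual_frame X (\<lambda>n s. k s (t + of_int n * T)) (\<lambda>n x. kd n x t)) \<longrightarrow>
            (\<forall>H \<in> op_class T \<phi>. AE t in lebesgue.
               impulse_response_in X H t \<in> X \<and>
               (AE x in lebesgue. impulse_response_in X H t x = impulse_response H t x) \<and>
               L2_has_sum lebesgue
                 (\<lambda>n x. indicator {0..T} t * delta_train_response X T H (t + of_int n * T) * kd n x t)
                 (impulse_response_in X H t) \<and>
               (\<forall>x. ((\<lambda>n. indicator {0..T} t * delta_train_response X T H (t + of_int n * T) * kd n x t)
                      has_sum impulse_response_in X H t x) UNIV)))"
proof -
  define S where "S = range (\<lambda>(n::int) x. \<phi> (x - of_int n * T))"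
  have V: "V_space T \<phi> = closed_span lebesgue S"
    by (simp add: V_space_def S_def)
  interpret rkhs S X k
  proof
    show "S \<subseteq> L2 lebesgue"
      using assms(3) by (auto simp: S_def riesz_sequence_def riesz_basis_def)
    show "function_space_of (closed_span lebesgue S) X" "reproducing_kernel X k"
      using assms(4,5) by (simp_all add: V)
  qed
  have op: "rkhs_operator S X k T H" if "H \<in> op_class T \<phi>" for H
    using that assms(1) by unfold_locales (auto simp: op_class_def V)
  have "\<exists>c>0. \<exists>C>0. \<forall>H \<in> op_class T \<phi>.
      delta_train_response X T H \<in> L2 lebesgue \<and>
      c * hs_norm H \<le> L2_norm lebesgue (delta_train_response X T H) \<and>
      L2_norm lebesgue (delta_train_response X T H) \<le> C * hs_norm H"
    if "uniform_frames X {0..T} (\<lambda>t (n::int) s. k s (t + of_int n * T))"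
  proof -
    obtain A B where AB: "frame_bounds X (\<lambda>(n::int) s. k s (t + of_int n * T)) A B" if "t \<in> {0..T}" for t
      using \<open>uniform_frames X {0..T} _\<close> unfolding uniform_frames_def by blast
    have "A > 0" "B > 0"
      using AB[of 0] assms(1) by (auto simp: frame_bounds_def)
    then show ?thesis
      using rkhs_operator.\<delta>_bounds[OF op AB]
      by (intro exI[of _ "sqrt A"] exI[of _ "sqrt B"] conjI ballI) auto
  qed
  moreover have "\<exists>kd :: int \<Rightarrow> real \<Rightarrow> real \<Rightarrow> complex. AE t in lebesgue. t \<in> {0..T} \<longrightarrow>
      dual_frame X (\<lambda>n s. k s (t + of_int n * T)) (\<lambda>n x. kd n x t)"
  proof -
    have "\<exists>g. dual_frame X (\<lambda>(n::int) s. k s (t + of_int n * T)) g" if t: "t \<in> {0..T}" for t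
    proof -
      obtain A B where "frame_bounds X (\<lambda>(n::int) s. k s (t + of_int n * T)) A B"
        using assms(6)[OF t] unfolding is_frame_def by blast
      then interpret rkhs_frame S X k "\<lambda>(n::int) s. k s (t + of_int n * T)" A B
        by unfold_locales
      show ?thesis by (rule dual_frame_exists)
    qed
    \<comment> \<open>The dual frame is chosen for each \<open>t\<close> separately, without any
      regularity in \<open>t\<close>; outside [0,T] the value is arbitrary.\<close>
    then obtain g where "dual_frame X (\<lambda>(n::int) s. k s (t + of_int n * T)) (g t)" if "t \<in> {0..T}" for t
      by metis
    then show ?thesis
      by (intro exI[of _ "\<lambda>n x t. g t n x"]) simp
  qed
  ultimately show ?thesis
    using rkhs_operator.reconstruction[OF op] by blast
qed

end
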